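(* Let $\Gamma$ be a connected metric graph carrying a potential $V$ as described in the context, and let $\psi$ be a real-valued eigenfunction of the quantum-graph Hamiltonian $H=-\frac{d^2}{dx^2}+V$ with Kirchhoff vertex conditions on $\Gamma$, with eigenvalue $E$. Let $W\subset\Gamma$ be a region (an open subset with nonempty boundary $\partial W$), let $\ell>0$, and set $$B_\ell:=\{x\in W:\ \operatorname{dist}(x,\partial W)\le \ell\}.$$ If $B_\ell$ contains no vertices of $\Gamma$, then for all $x\in W$ such that $\operatorname{dist}(x,\partial W)\ge \ell$, $$|\psi(x)|^2\le\left(\frac1{\ell^2}\int_{B_\ell}\psi^2+\int_W (E-V(y))_+\,\psi(y)^2\,dy\right)\operatorname{dist}(x,\partial W),$$ where $z_+:=\max(z,0)$.
   Context: A metric graph $\Gamma$ is a graph each of whose edges is identified with an interval (of finite or infinite length); $\operatorname{dist}$ is the path-length distance on $\Gamma$, and integrals are with respect to arc length. Standing assumptions: vertex degrees are uniformly bounded by some $d_{\max}<\infty$; every edge has length at least some fixed $L_{\min}>0$; the potential $V:\Gamma\to[0,\infty)$ is locally integrable; and for the eigenvalue $E$ considered, the set $\{x: V(x)\le E\}$ is compact. An eigenfunction with eigenvalue $E$ is an $L^2(\Gamma)$ function $\psi$ in the domain of the self-adjoint operator $H$ (defined from the form $\int_\Gamma |f'|^2+V|f|^2$ on continuous $H^1$ functions with finite form), i.e. $\psi$ is continuous on $\Gamma$, $\psi\in H^1(\Gamma)$, $\int_\Gamma V\psi^2<\infty$, $-\psi''+V\psi=E\psi$ on each edge, and $\psi$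 satisfies Kirchhoff conditions: at each vertex the sum of the outgoing derivatives of $\psi$ along all incident edges is $0$. *)

theory Defs
  imports "HOL-Analysis.Analysis"
begin

section \<open>Metric graphs\<close>

text \<open>
  Every edge \<open>e\<close> is identified with the closed interval of the real line from \<open>lo e\<close> to \<open>hi e\<close>
  (intersected with the reals, so that infinite ends are allowed). A finite end of the interval is
  glued to the vertex \<open>src e\<close> or \<open>tgt e\<close>; at an infinite end \<open>src e\<close> or \<open>tgt e\<close> is meaningless.
  Loops and parallel edges are allowed, and the choice of direction of an edge carries no meaning.
\<close>

record ('v, 'e) mgraph =
  verts :: "'v set"
  edges :: "'e set"
  lo :: "'e \<Rightarrow> ereal"
  hi :: "'e \<Rightarrow> ereal"
  src :: "'e \<Rightarrow> 'v"
  tgt :: "'e \<Rightarrow> 'v"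

datatype ('v, 'e) gpoint = Vertex 'v | Inner 'e real

definition edge_ivl :: "('v, 'e) mgraph \<Rightarrow> 'e \<Rightarrow> real set" where
  "edge_ivl G e = {t. lo G e \<le> ereal t \<and> ereal t \<le> hi G e}"

definition pt :: "('v, 'e) mgraph \<Rightarrow> 'e \<Rightarrow> real \<Rightarrow> ('v, 'e) gpoint" where
  "pt G e t = (if ereal t = lo G e then Vertex (src G e)
               else if ereal t = hi G e then Vertex (tgt G e)
               else Inner e t)"

definition points :: "('v, 'e) mgraph \<Rightarrow> ('v, 'e) gpoint set" where
  "points G = Vertex ` verts G \<union> {Inner e t | e t. e \<in> edges G \<and> lo G e < ereal t \<and> ereal t < hi G e}"

text \<open>Edges leaving a vertex through their lower, respectively upper, end; a loop is in both sets.\<close>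

definition lo_edges :: "('v, 'e) mgraph \<Rightarrow> 'v \<Rightarrow> 'e set" where
  "lo_edges G v = {e \<in> edges G. lo G e \<noteq> -\<infinity> \<and> src G e = v}"

definition hi_edges :: "('v, 'e) mgraph \<Rightarrow> 'v \<Rightarrow> 'e set" where
  "hi_edges G v = {e \<in> edges G. hi G e \<noteq> \<infinity> \<and> tgt G e = v}"

locale metric_graph =
  fixes G :: "('v, 'e) mgraph"
  assumes lo_less_hi: "e \<in> edges G \<Longrightarrow> lo G e < hi G e"
    and src_in_verts: "e \<in> edges G \<Longrightarrow> lo G e \<noteq> -\<infinity> \<Longrightarrow> src G e \<in> verts G"
    and tgt_in_verts: "e \<in> edges G \<Longrightarrow> hi G e \<noteq> \<infinity> \<Longrightarrow> tgt G e \<in> verts G"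

definition degree_bounded :: "('v, 'e) mgraph \<Rightarrow> nat \<Rightarrow> bool" where
  "degree_bounded G dmax \<longleftrightarrow>
     (\<forall>v\<in>verts G. finite (lo_edges G v) \<and> finite (hi_edges G v) \<and>
                   card (lo_edges G v) + card (hi_edges G v) \<le> dmax)"

definition edge_length_ge :: "('v, 'e) mgraph \<Rightarrow> real \<Rightarrow> bool" where
  "edge_length_ge G Lmin \<longleftrightarrow> (\<forall>e\<in>edges G. ereal Lmin \<le> hi G e - lo G e)"

subsection \<open>Path-length distance and topology\<close>

text \<open>\<open>route G x y r\<close>: a path of length \<open>r\<close> from \<open>x\<close> to \<open>y\<close>, made of finitely many edge segments.\<close>

inductive route :: "('v, 'e) mgraph \<Rightarrow> ('v, 'e) gpoint \<Rightarrow> ('v, 'e) gpoint \<Rightarrow> real \<Rightarrow> bool"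
  for G where
  route_refl: "x \<in> points G \<Longrightarrow> route G x x 0"
| route_step: "\<lbrakk>route G x (pt G e s) r; e \<in> edges G; s \<in> edge_ivl G e; t \<in> edge_ivl G e\<rbrakk>
     \<Longrightarrow> route G x (pt G e t) (r + \<bar>s - t\<bar>)"

definition connected_graph :: "('v, 'e) mgraph \<Rightarrow> bool" where
  "connected_graph G \<longleftrightarrow> (\<forall>x\<in>points G. \<forall>y\<in>points G. \<exists>r. route G x y r)"

text \<open>The value for unreachable pairs is irrelevant for connected graphs.\<close>

definition gdist :: "('v, 'e) mgraph \<Rightarrow> ('v, 'e) gpoint \<Rightarrow> ('v, 'e) gpoint \<Rightarrow> real" where
  "gdist G x y = (if \<exists>r. route G x y r then Inf {r. route G x y r} else 0)"

definition gtop :: "('v, 'e) mgraph \<Rightarrow> ('v, 'e) gpoint topology" where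
  "gtop G = Metric_space.mtopology (points G) (gdist G)"

definition gdist_set :: "('v, 'e) mgraph \<Rightarrow> ('v, 'e) gpoint \<Rightarrow> ('v, 'e) gpoint set \<Rightarrow> real" where
  "gdist_set G x S = (INF y\<in>S. gdist G x y)"

definition boundary_strip :: "('v, 'e) mgraph \<Rightarrow> ('v, 'e) gpoint set \<Rightarrow> real \<Rightarrow> ('v, 'e) gpoint set" where
  "boundary_strip G W l = {x \<in> W. gdist_set G x (gtop G frontier_of W) \<le> l}"

subsection \<open>Arc length\<close>

definition arc_length :: "('v, 'e) mgraph \<Rightarrow> ('v, 'e) gpoint measure" where
  "arc_length G = measure_of (points G)
     {A. A \<subseteq> points G \<and> (\<forall>e\<in>edges G. {t \<in> edge_ivl G e. pt G e t \<in> A} \<in> sets lebesgue)}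
     (\<lambda>A. \<integral>\<^sup>+ e. emeasure lebesgue {t \<in> edge_ivl G e. pt G e t \<in> A} \<partial>count_space (edges G))"

section \<open>The Schroedinger operator\<close>

definition loc_integrable :: "('v, 'e) mgraph \<Rightarrow> (('v, 'e) gpoint \<Rightarrow> real) \<Rightarrow> bool" where
  "loc_integrable G f \<longleftrightarrow> (\<forall>K. compactin (gtop G) K \<longrightarrow> set_integrable (arc_length G) K f)"

definition L2_on :: "('v, 'e) mgraph \<Rightarrow> (('v, 'e) gpoint \<Rightarrow> real) \<Rightarrow> bool" where
  "L2_on G f \<longleftrightarrow> f \<in> borel_measurable (arc_length G) \<and> integrable (arc_length G) (\<lambda>x. (f x)\<^sup>2)"

definition abs_cont_on :: "real set \<Rightarrow> (real \<Rightarrow> real) \<Rightarrow> bool" where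
  "abs_cont_on I f \<longleftrightarrow>
     (\<forall>\<epsilon>>0. \<exists>\<delta>>0. \<forall>\<D> S. \<D> division_of S \<and> S \<subseteq> I \<and> (\<Sum>K\<in>\<D>. Sup K - Inf K) < \<delta>
        \<longrightarrow> (\<Sum>K\<in>\<D>. \<bar>f (Sup K) - f (Inf K)\<bar>) < \<epsilon>)"

definition loc_abs_cont_on :: "real set \<Rightarrow> (real \<Rightarrow> real) \<Rightarrow> bool" where
  "loc_abs_cont_on I f \<longleftrightarrow> (\<forall>a b. {a..b} \<subseteq> I \<longrightarrow> abs_cont_on {a..b} f)"

text \<open>
  \<open>H1_on\<close> is the edgewise Sobolev space: locally absolutely continuous on each edge, with function and
  derivative square integrable over the whole graph. Continuity at the vertices is a separate condition.
\<close>

definition H1_on :: "('v, 'e) mgraph \<Rightarrow> (('v, 'e) gpoint \<Rightarrow> real) \<Rightarrow> bool" where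
  "H1_on G f \<longleftrightarrow> L2_on G f \<and>
     (\<exists>g. L2_on G g \<and>
        (\<forall>e\<in>edges G. loc_abs_cont_on (edge_ivl G e) (\<lambda>t. f (pt G e t)) \<and>
           (AE t in lebesgue. t \<in> edge_ivl G e \<longrightarrow>
              ((\<lambda>t. f (pt G e t)) has_real_derivative g (pt G e t)) (at t within edge_ivl G e))))"

text \<open>
  \<open>D e t\<close> is the derivative of \<open>\<psi>\<close> along \<open>e\<close> at \<open>t\<close> in the direction of increasing \<open>t\<close>, one-sided at
  the ends of the edge. As \<open>V\<close> is only locally integrable, the differential equation is understood in
  the usual sense: \<open>D e\<close> is locally absolutely continuous and its derivative \<open>\<psi>''\<close> equals
  \<open>(V - E) \<psi>\<close> almost everywhere. Out of a vertex, the derivative at a lower end is \<open>D e\<close>, that at an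
  upper end is \<open>- D e\<close>; a loop contributes both. The zero function is not excluded.
\<close>

definition eigenfunction ::
  "('v, 'e) mgraph \<Rightarrow> (('v, 'e) gpoint \<Rightarrow> real) \<Rightarrow> real \<Rightarrow> (('v, 'e) gpoint \<Rightarrow> real) \<Rightarrow> bool" where
  "eigenfunction G V E \<psi> \<longleftrightarrow>
     continuous_map (gtop G) euclideanreal \<psi> \<and>
     H1_on G \<psi> \<and>
     integrable (arc_length G) (\<lambda>x. V x * (\<psi> x)\<^sup>2) \<and>
     (\<exists>D.
       (\<forall>e\<in>edges G.
          (\<forall>t\<in>edge_ivl G e.
             ((\<lambda>t. \<psi> (pt G e t)) has_real_derivative D e t) (at t within edge_ivl G e)) \<and>
          loc_abs_cont_on (edge_ivl G e) (D e) \<and>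
          (AE t in lebesgue. t \<in> edge_ivl G e \<longrightarrow>
             (\<exists>\<psi>2. (D e has_real_derivative \<psi>2) (at t within edge_ivl G e) \<and>
                   - \<psi>2 + V (pt G e t) * \<psi> (pt G e t) = E * \<psi> (pt G e t)))) \<and>
       (\<forall>v\<in>verts G.
          (\<Sum>e\<in>lo_edges G v. D e (real_of_ereal (lo G e))) +
          (\<Sum>e\<in>hi_edges G v. - D e (real_of_ereal (hi G e))) = 0))"

section \<open>Basic facts\<close>

context metric_graph
begin

lemma pt_in_points:
  assumes "e \<in> edges G" "t \<in> edge_ivl G e"
  shows "pt G e t \<in> points G"
proof -
  have "src G e \<in> verts G" if "ereal t = lo G e"
    using src_in_verts[OF assms(1)] by (simp flip: that)
  moreover have "tgt G e \<in> verts G" if "ereal t = hi G e"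
    using tgt_in_verts[OF assms(1)] by (simp flip: that)
  ultimately show ?thesis
    using assms by (auto simp: pt_def points_def edge_ivl_def order_less_le)
qed

lemma route_points: "route G x y r \<Longrightarrow> x \<in> points G \<and> y \<in> points G"
  by (induction rule: route.induct) (auto intro: pt_in_points)

lemma route_nonneg: "route G x y r \<Longrightarrow> 0 \<le> r"
  by (induction rule: route.induct) auto

lemma route_trans: "route G y z s \<Longrightarrow> route G x y r \<Longrightarrow> route G x z (r + s)"
proof (induction rule: route.induct)
  case (route_step y e a s' b)
  then have "route G x (pt G e b) ((r + s') + \<bar>a - b\<bar>)"
    by (intro route.route_step) auto
  then show ?case by (simp add: add.assoc)
qed auto

lemma route_sym: "route G x y r \<Longrightarrow> route G y x r"
proof (induction rule: route.induct)
  case (route_step x e s r t)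
  have "route G (pt G e t) (pt G e s) (0 + \<bar>t - s\<bar>)"
    using route_step by (intro route.route_step route_refl pt_in_points)
  then have "route G (pt G e t) x ((0 + \<bar>t - s\<bar>) + r)"
    using route_step.IH route_trans by blast
  then show ?case by (simp add: add.commute abs_minus_commute)
qed (auto intro: route_refl)

lemma gdist_le: "route G x y r \<Longrightarrow> gdist G x y \<le> r"
  unfolding gdist_def by (auto intro!: cInf_lower bdd_belowI[of _ 0] dest: route_nonneg)

lemma gdist_nonneg: "0 \<le> gdist G x y"
  unfolding gdist_def by (auto intro!: cInf_greatest dest: route_nonneg)

lemma gdist_commute: "gdist G x y = gdist G y x"
proof -
  have "route G x y = route G y x" using route_sym by blast
  then show ?thesis by (simp add: gdist_def)
qed

lemma gdist_edge_le:
  assumes "e \<in> edges G" "s \<in> edge_ivl G e" "t \<in> edge_ivl G e"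
  shows "gdist G (pt G e s) (pt G e t) \<le> \<bar>s - t\<bar>"
  using gdist_le[OF route_step[OF route_refl[OF pt_in_points[OF assms(1,2)]] assms]] by simp

lemma route_lipschitz:
  assumes "\<And>e s t. \<lbrakk>e \<in> edges G; s \<in> edge_ivl G e; t \<in> edge_ivl G e\<rbrakk>
             \<Longrightarrow> \<phi> (pt G e t) - \<phi> (pt G e s) \<le> \<bar>s - t\<bar>"
  shows "route G x y r \<Longrightarrow> \<phi> y - \<phi> x \<le> (r::real)"
proof (induction rule: route.induct)
  case (route_step x e s r t)
  then show ?case using assms[of e s t] by linarith
qed auto

lemma gdist_pos:
  assumes L: "0 < Lmin" "edge_length_ge G Lmin" and "connected_graph G"
    and xy: "x \<in> points G" "y \<in> points G" "x \<noteq> y"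
  shows "0 < gdist G x y"
proof -
  have *: "0 < gdist G x y" if c: "0 < c" and \<phi>: "\<phi> x = 0" "\<phi> y \<ge> c"
    and lip: "\<And>e s t. \<lbrakk>e \<in> edges G; s \<in> edge_ivl G e; t \<in> edge_ivl G e\<rbrakk>
             \<Longrightarrow> \<phi> (pt G e t) - \<phi> (pt G e s) \<le> \<bar>s - t\<bar>" for \<phi> and c :: real
  proof -
    have "c \<le> r" if "route G x y r" for r
      using route_lipschitz[of \<phi>, OF lip that] \<phi> by linarith
    moreover have "\<exists>r. route G x y r"
      using assms by (auto simp: connected_graph_def)
    ultimately have "c \<le> gdist G x y"
      unfolding gdist_def by (auto intro!: cInf_greatest)
    with c show ?thesis by linarith
  qed
  show ?thesis
  proof (cases x)
    case (Inner e0 s0)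
    then have e0: "e0 \<in> edges G" "lo G e0 < ereal s0" "ereal s0 < hi G e0"
      using xy by (auto simp: points_def)
    obtain a where a: "lo G e0 < ereal a" "a < s0"
      using ereal_dense2[OF e0(2)] by auto
    obtain b where b: "ereal b < hi G e0" "s0 < b"
      using ereal_dense2[OF e0(3)] by auto
    define m where "m = min (s0 - a) (b - s0)"
    have m: "0 < m" using a b by (simp add: m_def)
    define \<phi> where "\<phi> p = (case p of Inner e t \<Rightarrow> if e = e0 then min m \<bar>t - s0\<bar> else m | Vertex v \<Rightarrow> m)"
      for p :: "('v, 'e) gpoint"
    have pt: "\<phi> (pt G e t) = (if e = e0 then min m \<bar>t - s0\<bar> else m)"
      if "e \<in> edges G" "t \<in> edge_ivl G e" for e t
    proof (cases "e = e0")
      case True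
      have "m \<le> \<bar>t - s0\<bar>" if "ereal t = lo G e0"
        using a by (simp add: m_def flip: that)
      moreover have "m \<le> \<bar>t - s0\<bar>" if "ereal t = hi G e0"
        using b by (simp add: m_def flip: that)
      ultimately show ?thesis using True by (simp add: \<phi>_def pt_def)
    qed (simp add: \<phi>_def pt_def)
    obtain c where c: "0 < c" "c \<le> \<phi> y"
    proof (cases y)
      case (Inner e t)
      then have "0 < \<phi> y" using Inner \<open>x = Inner e0 s0\<close> \<open>x \<noteq> y\<close> m by (auto simp: \<phi>_def)
      then show ?thesis using that by blast
    qed (use m that in \<open>auto simp: \<phi>_def\<close>)
    show ?thesis
    proof (rule *[of c \<phi>])
      show "\<phi> x = 0" using m Inner by (simp add: \<phi>_def)
      show "\<phi> (pt G e t) - \<phi> (pt G e s) \<le> \<bar>s - t\<bar>"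
        if "e \<in> edges G" "s \<in> edge_ivl G e" "t \<in> edge_ivl G e" for e s t
      proof -
        have "min m \<bar>t - s0\<bar> - min m \<bar>s - s0\<bar> \<le> \<bar>s - t\<bar>" by linarith
        then show ?thesis using that by (simp add: pt)
      qed
    qed (use c in auto)
  next
    case (Vertex v)
    define m where "m = Lmin / 2"
    have m: "0 < m" using L by (simp add: m_def)
    define dl where "dl e t = (if lo G e \<noteq> -\<infinity> \<and> src G e = v then min m (t - real_of_ereal (lo G e)) else m)" for e t
    define dh where "dh e t = (if hi G e \<noteq> \<infinity> \<and> tgt G e = v then min m (real_of_ereal (hi G e) - t) else m)" for e t
    define \<phi> where "\<phi> p = (case p of Inner e t \<Rightarrow> min (dl e t) (dh e t) | Vertex w \<Rightarrow> if w = v then 0 else m)"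
      for p :: "('v, 'e) gpoint"
    have pt: "\<phi> (pt G e t) = min (dl e t) (dh e t)" if "e \<in> edges G" "t \<in> edge_ivl G e" for e t
    proof -
      have len: "ereal Lmin \<le> hi G e - lo G e" using L that by (auto simp: edge_length_ge_def)
      consider "ereal t = lo G e" | "ereal t = hi G e" "ereal t \<noteq> lo G e"
        | "ereal t \<noteq> lo G e" "ereal t \<noteq> hi G e" by blast
      then show ?thesis
      proof cases
        case 1
        have "dh e t = m"
          using len m by (cases "hi G e") (simp_all add: dh_def m_def flip: 1)
        moreover have "dl e t = (if src G e = v then 0 else m)"
          using m by (simp add: dl_def flip: 1)
        ultimately show ?thesis using 1 m by (simp add: pt_def \<phi>_def)
      next
        case 2
        have "dl e t = m"
          using len m by (cases "lo G e") (simp_all add: dl_def m_def flip: 2(1))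
        moreover have "dh e t = (if tgt G e = v then 0 else m)"
          using m by (simp add: dh_def flip: 2(1))
        ultimately show ?thesis using 2 m by (simp add: pt_def \<phi>_def)
      qed (simp add: pt_def \<phi>_def)
    qed
    have lip: "\<phi> (pt G e t) - \<phi> (pt G e s) \<le> \<bar>s - t\<bar>"
      if "e \<in> edges G" "s \<in> edge_ivl G e" "t \<in> edge_ivl G e" for e s t
    proof -
      have "dl e t - dl e s \<le> \<bar>s - t\<bar>" by (auto simp: dl_def min_def)
      moreover have "dh e t - dh e s \<le> \<bar>s - t\<bar>" by (auto simp: dh_def min_def)
      ultimately show ?thesis using that by (simp add: pt min_def)
    qed
    obtain c where c: "0 < c" "c \<le> \<phi> y"
    proof (cases y)
      case (Inner e t)
      then have et: "e \<in> edges G" "lo G e < ereal t" "ereal t < hi G e" using xy by (auto simp: points_def)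
      then have "0 < dl e t" "0 < dh e t" using m
        by (cases "lo G e"; cases "hi G e"; simp add: dl_def dh_def)+
      then have "0 < \<phi> y" using Inner by (simp add: \<phi>_def)
      then show ?thesis using that by blast
    qed (use m that Vertex xy in \<open>auto simp: \<phi>_def\<close>)
    show ?thesis
      by (rule *[of c \<phi>]) (use c lip Vertex in \<open>simp_all add: \<phi>_def\<close>)
  qed
qed

lemma gdist_triangle:
  assumes "connected_graph G" "x \<in> points G" "y \<in> points G" "z \<in> points G"
  shows "gdist G x z \<le> gdist G x y + gdist G y z"
proof (rule field_le_epsilon)
  fix \<epsilon> :: real assume "0 < \<epsilon>"
  have *: "\<exists>r. route G p q r \<and> r < gdist G p q + \<epsilon> / 2" if "p \<in> points G" "q \<in> points G" for p q
  proof -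
    have ex: "\<exists>r. route G p q r" using that assms(1) unfolding connected_graph_def by blast
    then have "Inf {r. route G p q r} < gdist G p q + \<epsilon> / 2"
      using \<open>0 < \<epsilon>\<close> by (simp add: gdist_def)
    then show ?thesis using cInf_lessD[of "{r. route G p q r}"] ex by blast
  qed
  obtain r s where "route G x y r" "r < gdist G x y + \<epsilon> / 2" "route G y z s" "s < gdist G y z + \<epsilon> / 2"
    using *[OF assms(2,3)] *[OF assms(3,4)] by blast
  moreover from this have "gdist G x z \<le> r + s" using gdist_le route_trans by blast
  ultimately show "gdist G x z \<le> gdist G x y + gdist G y z + \<epsilon>" by linarith
qed

lemma Metric_space_gdist:
  assumes "0 < Lmin" "edge_length_ge G Lmin" "connected_graph G"
  shows "Metric_space (points G) (gdist G)"
proof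
  fix x y assume xy: "x \<in> points G" "y \<in> points G"
  have "gdist G x x \<le> 0" using gdist_le route_refl xy by blast
  then show "gdist G x y = 0 \<longleftrightarrow> x = y"
    using gdist_pos[OF assms xy] gdist_nonneg[of x x] by fastforce
qed (fact gdist_nonneg gdist_commute gdist_triangle[OF assms(3)])+

lemma edge_ivl_lebesgue: "edge_ivl G e \<in> sets lebesgue"
proof -
  have "closed (edge_ivl G e)"
    unfolding edge_ivl_def
    by (intro closed_Collect_conj closed_Collect_le continuous_intros continuous_on_ereal)
  then show ?thesis by simp
qed

lemma sigma_algebra_arc_length:
  "sigma_algebra (points G)
     {A. A \<subseteq> points G \<and> (\<forall>e\<in>edges G. {t \<in> edge_ivl G e. pt G e t \<in> A} \<in> sets lebesgue)}"
  (is "sigma_algebra _ ?S")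
  unfolding sigma_algebra_iff2
proof (intro conjI ballI allI impI)
  fix A assume A: "A \<in> ?S"
  have "{t \<in> edge_ivl G e. pt G e t \<in> points G - A} = edge_ivl G e - {t \<in> edge_ivl G e. pt G e t \<in> A}"
    if "e \<in> edges G" for e using pt_in_points[OF that] by auto
  then show "points G - A \<in> ?S" using A edge_ivl_lebesgue by auto
next
  fix A :: "nat \<Rightarrow> _" assume A: "range A \<subseteq> ?S"
  have eq: "{t \<in> edge_ivl G e. pt G e t \<in> (\<Union>i. A i)} = (\<Union>i. {t \<in> edge_ivl G e. pt G e t \<in> A i})" for e
    by auto
  show "(\<Union>i. A i) \<in> ?S"
    unfolding mem_Collect_eq eq using A by (intro conjI ballI sets.countable_UN) blast+
qed auto

lemma space_arc_length: "space (arc_length G) = points G"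
  unfolding arc_length_def by (rule space_measure_of) auto

lemma sets_arc_length:
  "sets (arc_length G) =
     {A. A \<subseteq> points G \<and> (\<forall>e\<in>edges G. {t \<in> edge_ivl G e. pt G e t \<in> A} \<in> sets lebesgue)}"
  unfolding arc_length_def
  by (subst sets_measure_of) (auto simp: sigma_algebra.sigma_sets_eq[OF sigma_algebra_arc_length])

lemma emeasure_arc_length:
  assumes "A \<in> sets (arc_length G)"
  shows "emeasure (arc_length G) A =
    (\<integral>\<^sup>+ e. emeasure lebesgue {t \<in> edge_ivl G e. pt G e t \<in> A} \<partial>count_space (edges G))"
proof (rule emeasure_measure_of[OF arc_length_def])
  show "countably_additive (sets (arc_length G))
     (\<lambda>A. \<integral>\<^sup>+ e. emeasure lebesgue {t \<in> edge_ivl G e. pt G e t \<in> A} \<partial>count_space (edges G))"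
    unfolding countably_additive_def
  proof (intro allI impI)
    fix A :: "nat \<Rightarrow> _" assume A: "range A \<subseteq> sets (arc_length G)" "disjoint_family A"
    have "(\<Sum>i. emeasure lebesgue {t \<in> edge_ivl G e. pt G e t \<in> A i}) =
            emeasure lebesgue {t \<in> edge_ivl G e. pt G e t \<in> (\<Union>i. A i)}" if e: "e \<in> edges G" for e
    proof -
      have "range (\<lambda>i. {t \<in> edge_ivl G e. pt G e t \<in> A i}) \<subseteq> sets lebesgue"
        using A(1) e by (auto simp: sets_arc_length)
      moreover have "disjoint_family (\<lambda>i. {t \<in> edge_ivl G e. pt G e t \<in> A i})"
        using A(2) by (auto simp: disjoint_family_on_def)
      moreover have "{t \<in> edge_ivl G e. pt G e t \<in> (\<Union>i. A i)} = (\<Union>i. {t \<in> edge_ivl G e. pt G e t \<in> A i})"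
        by auto
      ultimately show ?thesis
        using suminf_emeasure[of "\<lambda>i. {t \<in> edge_ivl G e. pt G e t \<in> A i}" lebesgue] by simp
    qed
    then show "(\<Sum>i. \<integral>\<^sup>+ e. emeasure lebesgue {t \<in> edge_ivl G e. pt G e t \<in> A i} \<partial>count_space (edges G)) =
      (\<integral>\<^sup>+ e. emeasure lebesgue {t \<in> edge_ivl G e. pt G e t \<in> (\<Union>i. A i)} \<partial>count_space (edges G))"
      by (subst nn_integral_suminf[symmetric]) (auto intro!: nn_integral_cong)
  qed
qed (use assms in \<open>auto simp: positive_def\<close>)

end

end

theory Submission
  imports Defs
begin

text \<open>
  Multiply \<open>\<psi>\<close> by a cutoff \<open>\<eta>\<close> that is \<open>0\<close> outside \<open>W\<close>, is \<open>1\<close> at distance at least \<open>l\<close> from the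
  frontier, and has slope \<open>0\<close> or \<open>\<plusminus> 1 / l\<close>, nonzero only in the boundary strip. On each edge
  \<open>((\<eta> \<psi>)')\<^sup>2 = (\<eta>\<^sup>2 \<psi> \<psi>')' + (\<eta>')\<^sup>2 \<psi>\<^sup>2 + \<eta>\<^sup>2 (E - V) \<psi>\<^sup>2\<close>. When this is integrated over the graph,
  the boundary terms \<open>\<eta>\<^sup>2 \<psi> \<psi>'\<close> cancel at every vertex by the Kirchhoff condition, because \<open>\<eta>\<close> is \<open>0\<close>
  or \<open>1\<close> there (the strip has no vertices) and the family of boundary terms is absolutely summable (edge lengths are
  bounded below). So the integral of \<open>((\<eta> \<psi>)')\<^sup>2\<close> is at most the constant \<open>M\<close> in front of the distance.
  A route of length \<open>r\<close> from \<open>x\<close> to the frontier can be chosen without overlapping segments, and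
  Cauchy--Schwarz along it gives \<open>\<psi>(x)\<^sup>2 \<le> r M\<close>.
\<close>

section \<open>Absolutely continuous functions\<close>

text \<open>The integral of ((\<eta> \<psi>)')^2 is never formed. In its place stands an interval
  function: the increment of \<eta>^2 \<psi> \<psi>' plus the integral of a majorant of the two
  remaining terms. It is additive, nonnegative, and dominates the squared increment of \<eta> \<psi>
  divided by the length. These three properties are stable under concatenation, so they can be
  checked on short pieces where \<eta> is affine and then carried to segments, edges and routes.

  The obstacle is that the graph may have infinitely many edges, some of infinite length, while the
  fluxes cancel only when all edges are taken together. A route meets only finitely many segments,
  so its energy is first enlarged to that of whole edges and then to that of all edges; both steps
  rest on nonnegativity. On an unbounded edge this requires that no flux is lost at infinity, and
  the passage from edges to vertices requires absolute summability.

  As \<open>V\<close> is only locally integrable, \<psi>'' exists almost everywhere only, which is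
  why a fundamental theorem for absolutely continuous functions comes first.\<close>

lemma abs_cont_on_subset: "abs_cont_on I f \<Longrightarrow> J \<subseteq> I \<Longrightarrow> abs_cont_on J f"
  unfolding abs_cont_on_def by (meson order_trans)

lemma division_interval_obtain:
  fixes S :: "real set"
  assumes "\<D> division_of S" "K \<in> \<D>"
  obtains a b where "K = {a..b}" "K \<noteq> {}" "K \<subseteq> S"
  using division_ofD(2,3)[OF assms] division_ofD(4)[OF assms] that unfolding cbox_interval by metis

text \<open>Sums, products and Lipschitz functions are all covered by this domination criterion.\<close>

lemma abs_cont_on_dominated:
  assumes f: "abs_cont_on I f" and g: "abs_cont_on I g"
    and M: "\<And>x y. x \<in> I \<Longrightarrow> y \<in> I \<Longrightarrow> x \<le> y \<Longrightarrow> \<bar>h y - h x\<bar> \<le> M * (\<bar>f y - f x\<bar> + \<bar>g y - g x\<bar> + (y - x))"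
  shows "abs_cont_on I h"
  unfolding abs_cont_on_def
proof (intro allI impI)
  fix \<epsilon> :: real assume "0 < \<epsilon>"
  define N where "N = \<bar>M\<bar> + 1"
  have N: "0 < N" by (simp add: N_def)
  then have e: "0 < \<epsilon> / (3 * N)" using \<open>0 < \<epsilon>\<close> by simp
  obtain \<delta>1 where \<delta>1: "\<delta>1 > 0" "\<And>\<D> S. \<D> division_of S \<Longrightarrow> S \<subseteq> I \<Longrightarrow> (\<Sum>K\<in>\<D>. Sup K - Inf K) < \<delta>1
        \<Longrightarrow> (\<Sum>K\<in>\<D>. \<bar>f (Sup K) - f (Inf K)\<bar>) < \<epsilon> / (3 * N)"
    using f e unfolding abs_cont_on_def by meson
  obtain \<delta>2 where \<delta>2: "\<delta>2 > 0" "\<And>\<D> S. \<D> division_of S \<Longrightarrow> S \<subseteq> I \<Longrightarrow> (\<Sum>K\<in>\<D>. Sup K - Inf K) < \<delta>2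
        \<Longrightarrow> (\<Sum>K\<in>\<D>. \<bar>g (Sup K) - g (Inf K)\<bar>) < \<epsilon> / (3 * N)"
    using g e unfolding abs_cont_on_def by meson
  define \<delta> where "\<delta> = min (min \<delta>1 \<delta>2) (\<epsilon> / (3 * N))"
  have "(\<Sum>K\<in>\<D>. \<bar>h (Sup K) - h (Inf K)\<bar>) < \<epsilon>"
    if d: "\<D> division_of S" "S \<subseteq> I" "(\<Sum>K\<in>\<D>. Sup K - Inf K) < \<delta>" for \<D> S
  proof -
    have "(\<Sum>K\<in>\<D>. \<bar>h (Sup K) - h (Inf K)\<bar>) \<le>
      (\<Sum>K\<in>\<D>. N * (\<bar>f (Sup K) - f (Inf K)\<bar> + \<bar>g (Sup K) - g (Inf K)\<bar> + (Sup K - Inf K)))"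
    proof (rule sum_mono)
      fix K assume "K \<in> \<D>"
      then obtain a b where "K = {a..b}" "K \<noteq> {}" "K \<subseteq> S"
        by (rule division_interval_obtain[OF d(1)])
      then have K: "Sup K \<in> I" "Inf K \<in> I" "Inf K \<le> Sup K" using d by auto
      have "\<bar>h (Sup K) - h (Inf K)\<bar> \<le> M * (\<bar>f (Sup K) - f (Inf K)\<bar> + \<bar>g (Sup K) - g (Inf K)\<bar> + (Sup K - Inf K))"
        using M K by blast
      also have "\<dots> \<le> N * (\<bar>f (Sup K) - f (Inf K)\<bar> + \<bar>g (Sup K) - g (Inf K)\<bar> + (Sup K - Inf K))"
        using K by (intro mult_right_mono) (auto simp: N_def)
      finally show "\<bar>h (Sup K) - h (Inf K)\<bar> \<le> \<dots>" .
    qed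
    also have "\<dots> = N * ((\<Sum>K\<in>\<D>. \<bar>f (Sup K) - f (Inf K)\<bar>) + (\<Sum>K\<in>\<D>. \<bar>g (Sup K) - g (Inf K)\<bar>)
        + (\<Sum>K\<in>\<D>. Sup K - Inf K))"
      by (simp only: sum_distrib_left[symmetric] sum.distrib)
    also have "\<dots> < N * (\<epsilon> / (3 * N) + \<epsilon> / (3 * N) + \<epsilon> / (3 * N))"
      using \<delta>1(2)[OF d(1,2)] \<delta>2(2)[OF d(1,2)] d(3) N
      by (intro mult_strict_left_mono add_strict_mono) (auto simp: \<delta>_def)
    also have "\<dots> = \<epsilon>" using N by (simp add: field_simps)
    finally show ?thesis .
  qed
  moreover have "0 < \<delta>" using \<delta>1 \<delta>2 e by (simp add: \<delta>_def)
  ultimately show "\<exists>\<delta>>0. \<forall>\<D> S. \<D> division_of S \<and> S \<subseteq> I \<and> (\<Sum>K\<in>\<D>. Sup K - Inf K) < \<delta>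
        \<longrightarrow> (\<Sum>K\<in>\<D>. \<bar>h (Sup K) - h (Inf K)\<bar>) < \<epsilon>" by blast
qed

lemma abs_cont_on_const: "abs_cont_on I (\<lambda>x. c)"
  unfolding abs_cont_on_def by (auto intro: exI[of _ 1])

lemma abs_cont_on_affine: "abs_cont_on I (\<lambda>x. c + m * x)"
  by (rule abs_cont_on_dominated[OF abs_cont_on_const abs_cont_on_const, where M = "\<bar>m\<bar>"])
    (simp add: abs_mult flip: right_diff_distrib)

lemma abs_cont_on_add:
  assumes "abs_cont_on I f" "abs_cont_on I g"
  shows "abs_cont_on I (\<lambda>x. f x + g x)"
  by (rule abs_cont_on_dominated[OF assms, where M = 1]) auto

text \<open>A division with a single interval turns absolute continuity into uniform
  continuity.\<close>

lemma abs_cont_on_imp_continuous_on: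
  assumes "abs_cont_on {a..b} f"
  shows "continuous_on {a..b} f"
  unfolding continuous_on_iff
proof (intro ballI allI impI)
  fix x \<epsilon> :: real assume x: "x \<in> {a..b}" and "0 < \<epsilon>"
  then obtain \<delta> where \<delta>: "\<delta> > 0" "\<And>\<D> S. \<D> division_of S \<Longrightarrow> S \<subseteq> {a..b} \<Longrightarrow> (\<Sum>K\<in>\<D>. Sup K - Inf K) < \<delta>
        \<Longrightarrow> (\<Sum>K\<in>\<D>. \<bar>f (Sup K) - f (Inf K)\<bar>) < \<epsilon>"
    using assms unfolding abs_cont_on_def by meson
  have *: "\<bar>f v - f u\<bar> < \<epsilon>" if "u \<le> v" "a \<le> u" "v \<le> b" "v - u < \<delta>" for u v
  proof -
    have "{{u..v}} division_of {u..v}"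
      using that using division_of_self[of u v] by auto
    then show ?thesis using \<delta>(2)[of "{{u..v}}" "{u..v}"] that by auto
  qed
  have "dist (f y) (f x) < \<epsilon>" if "y \<in> {a..b}" "dist y x < \<delta>" for y
    using *[of x y] *[of y x] that x by (cases "x \<le> y") (auto simp: dist_real_def)
  then show "\<exists>d>0. \<forall>y\<in>{a..b}. dist y x < d \<longrightarrow> dist (f y) (f x) < \<epsilon>" using \<delta>(1) by blast
qed

lemma abs_cont_on_bounded:
  assumes "abs_cont_on {a..b} f"
  obtains M :: real where "0 \<le> M" "\<And>x. x \<in> {a..b} \<Longrightarrow> \<bar>f x\<bar> \<le> M"
proof -
  have "bounded (f ` {a..b})"
    using abs_cont_on_imp_continuous_on[OF assms] by (intro compact_imp_bounded compact_continuous_image) auto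
  then obtain M where "\<forall>x\<in>{a..b}. \<bar>f x\<bar> \<le> M" unfolding bounded_real by blast
  then show ?thesis by (intro that[of "max M 0"]) force+
qed

text \<open>On a compact interval both factors are bounded, and their bounds give the constant of
  the domination criterion.\<close>

lemma abs_cont_on_mult:
  assumes "abs_cont_on {a..b} f" "abs_cont_on {a..b} g"
  shows "abs_cont_on {a..b} (\<lambda>x. f x * g x)"
proof -
  obtain A B where A: "0 \<le> A" "\<And>x. x \<in> {a..b} \<Longrightarrow> \<bar>f x\<bar> \<le> A"
    and B: "0 \<le> B" "\<And>x. x \<in> {a..b} \<Longrightarrow> \<bar>g x\<bar> \<le> B"
    using abs_cont_on_bounded assms by metis
  show ?thesis
  proof (rule abs_cont_on_dominated[OF assms, where M = "A + B"])
    fix x y assume xy: "x \<in> {a..b}" "y \<in> {a..b}" "x \<le> y"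
    have "f y * g y - f x * g x = f y * (g y - g x) + (f y - f x) * g x" by algebra
    then have "\<bar>f y * g y - f x * g x\<bar> \<le> \<bar>f y\<bar> * \<bar>g y - g x\<bar> + \<bar>f y - f x\<bar> * \<bar>g x\<bar>"
      by (metis abs_mult abs_triangle_ineq)
    also have "\<dots> \<le> A * \<bar>g y - g x\<bar> + \<bar>f y - f x\<bar> * B"
      using A B xy by (intro add_mono mult_mono) auto
    \<comment> \<open>The last summand is nonnegative and is added only to reach the shape of the
      criterion.\<close>
    also have "\<dots> \<le> (A + B) * \<bar>g y - g x\<bar> + \<bar>f y - f x\<bar> * (A + B) + (A + B) * (y - x)"
      using A(1) B(1) xy by (smt (verit) mult_left_mono mult_nonneg_nonneg mult_right_mono abs_ge_zero)
    finally show "\<bar>f y * g y - f x * g x\<bar> \<le> (A + B) * (\<bar>f y - f x\<bar> + \<bar>g y - g x\<bar> + (y - x))"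
      by (simp add: algebra_simps)
  qed
qed

section \<open>The fundamental theorem of calculus for absolutely continuous functions\<close>

lemma DERIV_within_bound:
  assumes f: "(f has_real_derivative q) (at x within S)" and "0 < e"
  obtains d where "0 < d" "\<And>y. y \<in> S \<Longrightarrow> \<bar>y - x\<bar> < d \<Longrightarrow> \<bar>f y - f x - (y - x) * q\<bar> \<le> e * \<bar>y - x\<bar>"
proof -
  have "\<forall>e>0. \<exists>d>0. \<forall>y\<in>S. norm (y - x) < d \<longrightarrow> norm (f y - f x - q * (y - x)) \<le> e * norm (y - x)"
    using f unfolding has_field_derivative_def has_derivative_within_alt by blast
  then obtain d where "0 < d" "\<forall>y\<in>S. norm (y - x) < d \<longrightarrow> norm (f y - f x - q * (y - x)) \<le> e * norm (y - x)"
    using \<open>0 < e\<close> by blast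
  then show ?thesis using that[of d] by (simp add: mult.commute)
qed

text \<open>On a tag set of measure zero the gauge keeps the intervals inside an open set of small measure,
  where absolute continuity bounds their contribution.\<close>

theorem abs_cont_on_fundamental_theorem:
  assumes "a \<le> b" and ac: "abs_cont_on {a..b} f" and N: "N \<in> null_sets lebesgue"
    and der: "\<And>x. x \<in> {a..b} - N \<Longrightarrow> (f has_real_derivative q x) (at x within {a..b})"
  shows "(q has_integral (f b - f a)) {a..b}"
proof -
  \<comment> \<open>Changing the integrand on a null set is free, and the value 0 removes the
    Riemann terms of tags in \<open>N\<close>; at those tags only increments of \<open>f\<close>
    remain to be estimated.\<close>
  define q0 where "q0 x = (if x \<in> N then 0 else q x)" for x
  have "(q0 has_integral (f b - f a)) {a..b}"
    unfolding has_integral_real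
  proof (intro allI impI)
    fix \<epsilon> :: real assume "0 < \<epsilon>"
    \<comment> \<open>Half of \<epsilon> is for tags outside \<open>N\<close>, the other half for
      tags in \<open>N\<close>. The \<open>+ 1\<close> keeps the denominator positive when
      \<open>a = b\<close>.\<close>
    define e where "e = \<epsilon> / (2 * (b - a + 1))"
    have e: "0 < e" "e * (b - a) \<le> \<epsilon> / 2" using \<open>0 < \<epsilon>\<close> \<open>a \<le> b\<close> by (auto simp: e_def field_simps)
    obtain \<delta> where \<delta>: "\<delta> > 0" "\<And>\<D> S. \<D> division_of S \<Longrightarrow> S \<subseteq> {a..b} \<Longrightarrow> (\<Sum>K\<in>\<D>. Sup K - Inf K) < \<delta>
        \<Longrightarrow> (\<Sum>K\<in>\<D>. \<bar>f (Sup K) - f (Inf K)\<bar>) < \<epsilon> / 2"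
      using ac half_gt_zero[OF \<open>0 < \<epsilon>\<close>] unfolding abs_cont_on_def by meson
    obtain U where U: "open U" "N \<subseteq> U" "(U - N) \<in> lmeasurable" "emeasure lebesgue (U - N) < ennreal \<delta>"
      using sets_lebesgue_outer_open[of N \<delta>] N \<delta>(1) by (auto simp: null_sets_def)
    have "emeasure lebesgue U = emeasure lebesgue (U - N)"
      using emeasure_Diff_null_set[of N lebesgue U] N U(1) by (simp add: borel_open)
    with U(4) have eU: "emeasure lebesgue U < ennreal \<delta>" by simp
    have "\<exists>d>0. (x \<in> N \<longrightarrow> ball x d \<subseteq> U) \<and> (x \<in> {a..b} - N \<longrightarrow>
        (\<forall>y\<in>{a..b}. \<bar>y - x\<bar> < d \<longrightarrow> \<bar>f y - f x - (y - x) * q x\<bar> \<le> e * \<bar>y - x\<bar>))" for x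
    proof (cases "x \<in> N")
      case True
      then have "x \<in> U" using U(2) by blast
      then obtain d where "0 < d" "ball x d \<subseteq> U" using U(1) openE by blast
      then show ?thesis using True by auto
    next
      case False
      show ?thesis
      proof (cases "x \<in> {a..b}")
        case True
        then have "(f has_real_derivative q x) (at x within {a..b})" using der False by auto
        then obtain d where "0 < d"
            "\<And>y. y \<in> {a..b} \<Longrightarrow> \<bar>y - x\<bar> < d \<Longrightarrow> \<bar>f y - f x - (y - x) * q x\<bar> \<le> e * \<bar>y - x\<bar>"
          by (rule DERIV_within_bound[OF _ e(1)]) (rule that)
        then show ?thesis using False by auto
      qed (use False in \<open>auto intro: exI[of _ 1]\<close>)
    qed
    then obtain d where d: "\<And>x. 0 < d x" "\<And>x. x \<in> N \<Longrightarrow> ball x (d x) \<subseteq> U"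
      "\<And>x y. x \<in> {a..b} - N \<Longrightarrow> y \<in> {a..b} \<Longrightarrow> \<bar>y - x\<bar> < d x \<Longrightarrow> \<bar>f y - f x - (y - x) * q x\<bar> \<le> e * \<bar>y - x\<bar>"
      by metis
    show "\<exists>\<gamma>. gauge \<gamma> \<and> (\<forall>p. p tagged_division_of {a..b} \<and> \<gamma> fine p \<longrightarrow>
       norm ((\<Sum>(x,K)\<in>p. measure lborel K *\<^sub>R q0 x) - (f b - f a)) < \<epsilon>)"
    proof (rule exI, safe)
      show "gauge (\<lambda>x. ball x (d x))" using d(1) gauge_ball_dependent by blast
    next
      fix p assume p: "p tagged_division_of {a..b}" and fine: "(\<lambda>x. ball x (d x)) fine p"
      have fin: "finite p" using p by blast
      have ba: "b - a = (\<Sum>(x,K)\<in>p. Sup K - Inf K)" "f b - f a = (\<Sum>(x,K)\<in>p. f (Sup K) - f (Inf K))"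
        using additive_tagged_division_1[OF \<open>a \<le> b\<close>, of p "\<lambda>x. x"] additive_tagged_division_1[OF \<open>a \<le> b\<close>, of p f] p
        by auto
      define r where "r = {z \<in> p. fst z \<in> N}"
      have K: "\<exists>u v. K = {u..v} \<and> u \<le> v \<and> u \<le> x \<and> x \<le> v \<and> a \<le> u \<and> v \<le> b \<and> {u..v} \<subseteq> ball x (d x)"
        if "(x, K) \<in> p" for x K
      proof -
        have "x \<in> K" "K \<subseteq> {a..b}" "K \<subseteq> ball x (d x)" using p fine that by (auto simp: fine_def)
        moreover obtain u v where "K = cbox u v" using p \<open>(x, K) \<in> p\<close> by blast
        ultimately show ?thesis by (intro exI[of _ u] exI[of _ v]) auto
      qed
      have rp: "r tagged_partial_division_of {a..b}"
        using p unfolding tagged_division_of_def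
        by (rule tagged_partial_division_subset[OF conjunct1]) (simp add: r_def)
      have K_ne: "(x, {}) \<notin> p" for x using K[of x "{}"] by auto
      have "norm ((\<Sum>(x,K)\<in>p. measure lborel K *\<^sub>R q0 x) - (f b - f a))
          = norm (\<Sum>(x,K)\<in>p. measure lborel K *\<^sub>R q0 x - (f (Sup K) - f (Inf K)))"
        unfolding ba by (simp add: split_def sum_subtractf)
      also have "\<dots> \<le> (\<Sum>z\<in>p. (if fst z \<in> N then \<bar>f (Sup (snd z)) - f (Inf (snd z))\<bar> else 0) + e * (Sup (snd z) - Inf (snd z)))"
      proof (rule sum_norm_le, safe)
        fix x K assume xK: "(x, K) \<in> p"
        then obtain u v where uv: "K = {u..v}" "u \<le> v" "u \<le> x" "x \<le> v" "a \<le> u" "v \<le> b" "{u..v} \<subseteq> ball x (d x)"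
          using K by blast
        show "norm (measure lborel K *\<^sub>R q0 x - (f (Sup K) - f (Inf K))) \<le>
          (if fst (x,K) \<in> N then \<bar>f (Sup (snd (x,K))) - f (Inf (snd (x,K)))\<bar> else 0) + e * (Sup (snd (x,K)) - Inf (snd (x,K)))"
        proof (cases "x \<in> N")
          case True
          moreover have "0 \<le> e * (v - u)" using uv e(1) by simp
          ultimately show ?thesis using uv by (simp add: q0_def)
        next
          case False
          have "u \<in> {u..v}" "v \<in> {u..v}" using uv by auto
          then have "u \<in> ball x (d x)" "v \<in> ball x (d x)" using uv by blast+
          then have "\<bar>u - x\<bar> < d x" "\<bar>v - x\<bar> < d x" by (auto simp: dist_real_def)
          then have "\<bar>f u - f x - (u - x) * q x\<bar> \<le> e * \<bar>u - x\<bar>" "\<bar>f v - f x - (v - x) * q x\<bar> \<le> e * \<bar>v - x\<bar>"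
            using d(3)[of x u] d(3)[of x v] uv False by auto
          \<comment> \<open>The tag lies between the ends, so the two errors add up to exactly
            \<open>e\<close> times the length of the interval.\<close>
          moreover have "e * \<bar>u - x\<bar> = e * x - e * u" "e * \<bar>v - x\<bar> = e * v - e * x"
            using uv by (auto simp: algebra_simps)
          ultimately have "\<bar>(v - u) * q x - (f v - f u)\<bar> \<le> e * v - e * u"
            by (simp add: left_diff_distrib)
          then show ?thesis using False uv by (simp add: q0_def algebra_simps)
        qed
      qed
      also have "\<dots> = (\<Sum>z\<in>p. if fst z \<in> N then \<bar>f (Sup (snd z)) - f (Inf (snd z))\<bar> else 0) + e * (b - a)"
        unfolding ba by (simp add: sum.distrib sum_distrib_left split_def)
      also have "(\<Sum>z\<in>p. if fst z \<in> N then \<bar>f (Sup (snd z)) - f (Inf (snd z))\<bar> else 0)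
          = (\<Sum>(x,K)\<in>r. \<bar>f (Sup K) - f (Inf K)\<bar>)"
        unfolding r_def using fin by (simp add: sum.If_cases split_def Int_def)
      \<comment> \<open>The sum over tagged intervals becomes a sum over intervals. Two tags can
        share an interval only if it is degenerate, where the increment of \<open>f\<close> is 0;
        the empty interval gets the value 0 by hand, because its \<open>Sup\<close> and
        \<open>Inf\<close> say nothing.\<close>
      also have "\<dots> = (\<Sum>(x,K)\<in>r. if K = {} then 0 else \<bar>f (Sup K) - f (Inf K)\<bar>)"
        using K_ne by (intro sum.cong) (auto simp: r_def)
      also have "\<dots> = (\<Sum>K\<in>snd ` r. if K = {} then 0 else \<bar>f (Sup K) - f (Inf K)\<bar>)"
      proof (rule sum.over_tagged_division_lemma)
        show "r tagged_division_of \<Union>(snd ` r)"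
          by (rule tagged_partial_division_of_Union_self[OF rp])
      qed auto
      also have "\<dots> = (\<Sum>K\<in>snd ` r. \<bar>f (Sup K) - f (Inf K)\<bar>)"
        using K_ne by (intro sum.cong) (auto simp: r_def)
      also have "\<dots> < \<epsilon> / 2"
      proof (rule \<delta>(2))
        show div: "snd ` r division_of \<Union>(snd ` r)"
          by (rule partial_division_of_tagged_division[OF rp])
        show "\<Union>(snd ` r) \<subseteq> {a..b}" using K by (fastforce simp: r_def)
        have sub: "\<Union>(snd ` r) \<subseteq> U"
          using K d(2) by (fastforce simp: r_def)
        have "(\<Sum>K\<in>snd ` r. Sup K - Inf K) = (\<Sum>K\<in>snd ` r. measure lebesgue K)"
        proof (rule sum.cong)
          fix J assume "J \<in> snd ` r"
          then obtain x where "(x, J) \<in> p" by (auto simp: r_def)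
          from K[OF this] obtain u v where "J = {u..v}" "u \<le> v" by blast
          then show "Sup J - Inf J = measure lebesgue J" by simp
        qed simp
        also have "\<dots> = measure lebesgue (\<Union>(snd ` r))" by (rule content_division[OF div])
        also have "\<dots> < \<delta>"
        proof -
          have "emeasure lebesgue (\<Union>(snd ` r)) \<le> emeasure lebesgue U"
            using sub U(1) by (intro emeasure_mono) (auto simp: borel_open)
          then have "emeasure lebesgue (\<Union>(snd ` r)) < ennreal \<delta>" using eU by simp
          then show ?thesis
            using \<delta>(1) lmeasurable_division[OF div] by (simp add: emeasure_eq_measure2 ennreal_less_iff)
        qed
        finally show "(\<Sum>K\<in>snd ` r. Sup K - Inf K) < \<delta>" .
      qed
      finally show "norm ((\<Sum>(x,K)\<in>p. measure lborel K *\<^sub>R q0 x) - (f b - f a)) < \<epsilon>"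
        using e(2) by linarith
    qed
  qed
  moreover have "negligible N" using N negligible_iff_null_sets by blast
  ultimately show ?thesis
    by (rule has_integral_spike[rotated 2]) (auto simp: q0_def)
qed

section \<open>Tent cutoffs on an interval\<close>

text \<open>For positive \<open>l\<close> and nonempty \<open>U\<close> this is max(0, 1 - dist(t,
  U) / l), written as an upper envelope. The inserted 0 truncates at 0 and makes the function vanish
  for empty \<open>U\<close>, where a distance with default value 0 would give 1.\<close>

definition tent :: "real set \<Rightarrow> real \<Rightarrow> real \<Rightarrow> real" where
  "tent U l t = Sup (insert 0 ((\<lambda>u. 1 - \<bar>t - u\<bar> / l) ` U))"

lemma tent_eqI:
  assumes "0 \<le> v" "\<And>u. u \<in> U \<Longrightarrow> 1 - \<bar>t - u\<bar> / l \<le> v" "v = 0 \<or> (\<exists>u\<in>U. v = 1 - \<bar>t - u\<bar> / l)"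
  shows "tent U l t = v"
  unfolding tent_def using assms by (intro cSup_eq_maximum) auto

lemma tent_bounds:
  assumes "0 < l"
  shows tent_nonneg: "0 \<le> tent U l t" and tent_le_1: "tent U l t \<le> 1"
    and tent_ge: "u \<in> U \<Longrightarrow> 1 - \<bar>t - u\<bar> / l \<le> tent U l t"
proof -
  have le: "x \<le> 1" if "x \<in> insert 0 ((\<lambda>u. 1 - \<bar>t - u\<bar> / l) ` U)" for x
    using that assms by auto
  then have bdd: "bdd_above (insert 0 ((\<lambda>u. 1 - \<bar>t - u\<bar> / l) ` U))" by (rule bdd_aboveI)
  show "0 \<le> tent U l t" unfolding tent_def using bdd by (rule cSup_upper[rotated]) simp
  show "tent U l t \<le> 1" unfolding tent_def by (rule cSup_least[OF _ le]) auto
  show "u \<in> U \<Longrightarrow> 1 - \<bar>t - u\<bar> / l \<le> tent U l t"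
    unfolding tent_def using bdd by (intro cSup_upper) auto
qed

lemma tent_eq_1: "0 < l \<Longrightarrow> t \<in> U \<Longrightarrow> tent U l t = 1"
  using tent_ge[of l t U t] tent_le_1[of l U t] by simp

lemma tent_posD:
  assumes "0 < l" "0 < tent U l t"
  obtains u where "u \<in> U" "\<bar>t - u\<bar> < l"
proof (rule ccontr)
  assume "\<not> thesis"
  with that have "l \<le> \<bar>t - u\<bar>" if "u \<in> U" for u using \<open>u \<in> U\<close> not_le by blast
  then have "1 - \<bar>t - u\<bar> / l \<le> 0" if "u \<in> U" for u using assms that by simp
  then have "tent U l t = 0" by (intro tent_eqI) auto
  then show False using assms by simp
qed

lemma tent_uminus: "tent (uminus ` U) l (- t) = tent U l t"
proof -
  have "(\<lambda>u. 1 - \<bar>- t - u\<bar> / l) ` uminus ` U = (\<lambda>u. 1 - \<bar>t - u\<bar> / l) ` U"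
    unfolding image_image by (intro image_cong) (auto simp: abs_if)
  then show ?thesis by (simp add: tent_def)
qed

text \<open>As the gaps of \<open>U\<close> have length at least \<open>2 * l\<close>, at most one of the tents over the ends of a gap
  is positive at any point of it.\<close>

lemma tent_affine_right:
  assumes l: "0 < l" and U: "closed U"
    and gap: "\<And>x y. x \<in> U \<Longrightarrow> y \<in> U \<Longrightarrow> x < y \<Longrightarrow> y - x < 2 * l \<Longrightarrow> {x..y} \<subseteq> U"
  shows "\<exists>\<delta>>0. \<exists>c m. (m = 0 \<or> \<bar>m\<bar> = 1 / l) \<and> (\<forall>s\<in>{t..t + \<delta>}. tent U l s = c + m * s)"
proof (cases "t \<in> U")
  case tU: True
  show ?thesis
  \<comment> \<open>A point of \<open>U\<close> closer than \<open>2 * l\<close> fills the interval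
    up to it, so the tent stays 1. Otherwise the tents over later points are still 0 up to
    \<open>t + l\<close>, and the one over \<open>t\<close> alone is seen.\<close>
  proof (cases "\<exists>y\<in>U. t < y \<and> y < t + 2 * l")
    case True
    then obtain y where y: "y \<in> U" "t < y" "y < t + 2 * l" by blast
    then have "{t..y} \<subseteq> U" using gap[OF tU] by auto
    then have "\<forall>s\<in>{t..t + (y - t)}. tent U l s = 1 + 0 * s"
      using l by (auto simp: tent_eq_1)
    moreover have "0 < y - t" using y(2) by simp
    ultimately show ?thesis by blast
  next
    case False
    have "\<forall>s\<in>{t..t + l}. tent U l s = (1 + t / l) + (- 1 / l) * s"
    proof
      fix s assume s: "s \<in> {t..t + l}"
      have "tent U l s = 1 - \<bar>s - t\<bar> / l"
      proof (rule tent_eqI)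
        fix u assume "u \<in> U"
        then have "u \<le> t \<or> t + 2 * l \<le> u" using False by force
        then have "\<bar>s - t\<bar> \<le> \<bar>s - u\<bar>" using s by auto
        then show "1 - \<bar>s - u\<bar> / l \<le> 1 - \<bar>s - t\<bar> / l" using l by (simp add: divide_right_mono)
      next
        show "1 - \<bar>s - t\<bar> / l = 0 \<or> (\<exists>u\<in>U. 1 - \<bar>s - t\<bar> / l = 1 - \<bar>s - u\<bar> / l)" using tU by blast
      qed (use s l in auto)
      then show "tent U l s = (1 + t / l) + (- 1 / l) * s" using s l by (auto simp: diff_divide_distrib)
    qed
    moreover have "\<bar>- 1 / l\<bar> = 1 / l" using l by simp
    ultimately show ?thesis using l by blast
  qed
next
  case tU: False
  have right: "closed (U \<inter> {t..})" and left: "closed (U \<inter> {..t})" using U by auto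
  \<comment> \<open>The inequalities differ on purpose: a tent over a point at distance exactly
    \<open>l\<close> vanishes at \<open>t\<close>, but to the right of \<open>t\<close> it rises if
    that point lies to the right and stays 0 if it lies to the left.\<close>
  consider (down) x where "x \<in> U" "x < t" "t - x < l"
    | (up) x where "x \<in> U" "t < x" "x \<le> t + l" "\<forall>u\<in>U. u < t \<longrightarrow> l \<le> t - u"
    | (flat) "\<forall>u\<in>U. u < t \<longrightarrow> l \<le> t - u" "\<forall>u\<in>U. t < u \<longrightarrow> t + l < u"
    by force
  then show ?thesis
  proof cases
    case down
    define p where "p = Sup (U \<inter> {..t})"
    have bdd: "bdd_above (U \<inter> {..t})" by (auto intro: bdd_aboveI[of _ t])
    have "p \<in> U \<inter> {..t}" unfolding p_def using left down bdd by (intro closed_contains_Sup) auto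
    moreover have "x \<le> p" unfolding p_def using down bdd by (intro cSup_upper) auto
    ultimately have p: "p \<in> U" "p < t" "t - p < l" using tU down by (auto simp: order_less_le)
    have p_ub: "u \<le> p" if "u \<in> U" "u \<le> t" for u
      unfolding p_def using that bdd by (intro cSup_upper) auto
    have "\<forall>s\<in>{t..t + (p + l - t)}. tent U l s = (1 + p / l) + (- 1 / l) * s"
    proof
      fix s assume s: "s \<in> {t..t + (p + l - t)}"
      have "tent U l s = 1 - \<bar>s - p\<bar> / l"
      proof (rule tent_eqI)
        fix u assume u: "u \<in> U"
        \<comment> \<open>A point of \<open>U\<close> beyond \<open>t\<close> and closer than
          \<open>2 * l\<close> to \<open>p\<close> would put \<open>t\<close> itself into
          \<open>U\<close>.\<close>
        have "p + 2 * l \<le> u" if "t < u"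
        proof (rule ccontr)
          assume "\<not> ?thesis"
          then have "{p..u} \<subseteq> U" using gap[OF p(1) u] that p by auto
          moreover have "t \<in> {p..u}" using that p by simp
          ultimately show False using tU by blast
        qed
        then have "u \<le> p \<or> p + 2 * l \<le> u" using p_ub[OF u] by linarith
        then have "\<bar>s - p\<bar> \<le> \<bar>s - u\<bar>" using s p by auto
        then show "1 - \<bar>s - u\<bar> / l \<le> 1 - \<bar>s - p\<bar> / l" using l by (simp add: divide_right_mono)
      next
        show "1 - \<bar>s - p\<bar> / l = 0 \<or> (\<exists>u\<in>U. 1 - \<bar>s - p\<bar> / l = 1 - \<bar>s - u\<bar> / l)" using p by blast
      qed (use s l p in auto)
      then show "tent U l s = (1 + p / l) + (- 1 / l) * s" using s p l by (auto simp: diff_divide_distrib)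
    qed
    moreover have "\<bar>- 1 / l\<bar> = 1 / l" "0 < p + l - t" using l p by auto
    ultimately show ?thesis by blast
  next
    case up
    define p where "p = Inf (U \<inter> {t..})"
    have bdd: "bdd_below (U \<inter> {t..})" by (auto intro: bdd_belowI[of _ t])
    have "p \<in> U \<inter> {t..}" unfolding p_def using right up bdd by (intro closed_contains_Inf) auto
    moreover have "p \<le> x" unfolding p_def using up bdd by (intro cInf_lower) auto
    ultimately have p: "p \<in> U" "t < p" "p - t \<le> l" using tU up by (auto simp: order_less_le)
    have p_lb: "p \<le> u" if "u \<in> U" "t \<le> u" for u
      unfolding p_def using that bdd by (intro cInf_lower) auto
    have "\<forall>s\<in>{t..t + (p - t)}. tent U l s = (1 - p / l) + (1 / l) * s"
    proof
      fix s assume s: "s \<in> {t..t + (p - t)}"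
      have "tent U l s = 1 - \<bar>s - p\<bar> / l"
      proof (rule tent_eqI)
        fix u assume u: "u \<in> U"
        have "u \<le> t - l \<or> p \<le> u" using p_lb[OF u] up(4) u by (cases "u < t") force+
        then have "\<bar>s - p\<bar> \<le> \<bar>s - u\<bar>" using s p by auto
        then show "1 - \<bar>s - u\<bar> / l \<le> 1 - \<bar>s - p\<bar> / l" using l by (simp add: divide_right_mono)
      next
        show "1 - \<bar>s - p\<bar> / l = 0 \<or> (\<exists>u\<in>U. 1 - \<bar>s - p\<bar> / l = 1 - \<bar>s - u\<bar> / l)" using p by blast
      qed (use s l p in auto)
      then show "tent U l s = (1 - p / l) + (1 / l) * s" using s p l by (auto simp: diff_divide_distrib)
    qed
    moreover have "\<bar>1 / l\<bar> = 1 / l" "0 < p - t" using l p by auto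
    ultimately show ?thesis by blast
  next
    case flat
    \<comment> \<open>The next point of \<open>U\<close> lies strictly beyond \<open>t + l\<close>,
      and closedness leaves a positive margin before its tent begins to rise.\<close>
    have "t + l \<notin> U" using flat l by force
    then obtain \<delta> where \<delta>: "0 < \<delta>" "ball (t + l) \<delta> \<subseteq> - U"
      using U openE[of "- U" "t + l"] by auto
    have "\<forall>s\<in>{t..t + \<delta> / 2}. tent U l s = 0 + 0 * s"
    proof
      fix s assume s: "s \<in> {t..t + \<delta> / 2}"
      have "tent U l s = 0"
      proof (rule tent_eqI)
        fix u assume u: "u \<in> U"
        then have "u \<notin> ball (t + l) \<delta>" using \<delta> by blast
        then have "u \<le> t - l \<or> t + l + \<delta> \<le> u"
          using flat u tU by (force simp: dist_real_def)
        then have "l \<le> \<bar>s - u\<bar>" using s \<delta>(1) by auto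
        then show "1 - \<bar>s - u\<bar> / l \<le> 0" using l by simp
      qed auto
      then show "tent U l s = 0 + 0 * s" by simp
    qed
    then show ?thesis using half_gt_zero[OF \<delta>(1)] by blast
  qed
qed

text \<open>Reflection at 0 exchanges the two sides and preserves closedness and the gap
  condition.\<close>

lemma tent_affine_left:
  assumes l: "0 < l" and U: "closed U"
    and gap: "\<And>x y. x \<in> U \<Longrightarrow> y \<in> U \<Longrightarrow> x < y \<Longrightarrow> y - x < 2 * l \<Longrightarrow> {x..y} \<subseteq> U"
  shows "\<exists>\<delta>>0. \<exists>c m. (m = 0 \<or> \<bar>m\<bar> = 1 / l) \<and> (\<forall>s\<in>{t - \<delta>..t}. tent U l s = c + m * s)"
proof -
  have "\<exists>\<delta>>0. \<exists>c m. (m = 0 \<or> \<bar>m\<bar> = 1 / l) \<and> (\<forall>s\<in>{- t..- t + \<delta>}. tent (uminus ` U) l s = c + m * s)"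
  proof (rule tent_affine_right[OF l])
    show "closed (uminus ` U)" using U by (rule closed_negations)
    fix x y assume xy: "x \<in> uminus ` U" "y \<in> uminus ` U" "x < y" "y - x < 2 * l"
    then have "{- y..- x} \<subseteq> U" by (intro gap) auto
    then have "z \<in> uminus ` U" if "z \<in> {x..y}" for z
      using that by (intro image_eqI[of _ _ "- z"]) auto
    then show "{x..y} \<subseteq> uminus ` U" by blast
  qed
  then obtain \<delta> c m where d: "\<delta> > 0" "m = 0 \<or> \<bar>m\<bar> = 1 / l"
    "\<And>s. s \<in> {- t..- t + \<delta>} \<Longrightarrow> tent (uminus ` U) l s = c + m * s" by blast
  have "tent U l s = c + (- m) * s" if "s \<in> {t - \<delta>..t}" for s
    using d(3)[of "- s"] that by (simp add: tent_uminus)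
  moreover have "- m = 0 \<or> \<bar>- m\<bar> = 1 / l" using d(2) by simp
  ultimately show ?thesis using d(1) by blast
qed

section \<open>The energy of a localized solution on an interval\<close>

text \<open>The quadratic polynomial in the mean slope \<open>k\<close> of \<open>h \<psi>\<close> that is integrated here is
  \<open>((h \<psi>)' - k)\<^sup>2\<close>; this gives Cauchy--Schwarz for \<open>(h \<psi>)'\<close>.\<close>

lemma affine_cutoff_energy:
  fixes \<psi> D V \<kappa> :: "real \<Rightarrow> real"
  assumes "a \<le> b"
    and \<psi>: "\<And>x. x \<in> {a..b} \<Longrightarrow> (\<psi> has_real_derivative D x) (at x within {a..b})"
    and ac: "abs_cont_on {a..b} \<psi>" "abs_cont_on {a..b} D"
    and N: "N \<in> null_sets lebesgue"
    and D: "\<And>x. x \<in> {a..b} - N \<Longrightarrow> (D has_real_derivative (V x - E) * \<psi> x) (at x within {a..b})"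
    and \<kappa>: "\<kappa> integrable_on {a..b}"
    and bound: "\<And>x. x \<in> {a<..<b} \<Longrightarrow> m\<^sup>2 * (\<psi> x)\<^sup>2 + (c + m * x)\<^sup>2 * (E - V x) * (\<psi> x)\<^sup>2 \<le> \<kappa> x"
  shows "((c + m * b) * \<psi> b - (c + m * a) * \<psi> a)\<^sup>2 \<le>
    (b - a) * ((c + m * b)\<^sup>2 * \<psi> b * D b - (c + m * a)\<^sup>2 * \<psi> a * D a + integral {a..b} \<kappa>)"
proof (cases "a = b")
  case False
  then have "a < b" using \<open>a \<le> b\<close> by simp
  define f where "f x = (c + m * x) * \<psi> x" for x
  define k where "k = (f b - f a) / (b - a)"
  have k: "k * (b - a) = f b - f a" using \<open>a < b\<close> by (simp add: k_def)
  \<comment> \<open>With h = c + m x, the first summand is the boundary term h^2 \<psi> \<psi>'. By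
    the differential equation its derivative is (f')^2 minus the two terms bounded by
    \<open>\<kappa>\<close>; the other summands complete (f')^2 to (f' - k)^2. The summand
    \<open>0\<close> gives the shape of \<open>abs_cont_on_affine\<close>.\<close>
  define F where "F x = f x * ((c + m * x) * D x) + (- 2 * k * f x + (0 + k\<^sup>2 * x))" for x
  define q where "q x = (m * \<psi> x + (c + m * x) * D x - k)\<^sup>2
      - (m\<^sup>2 * (\<psi> x)\<^sup>2 + (c + m * x)\<^sup>2 * (E - V x) * (\<psi> x)\<^sup>2)" for x
  have f_ac: "abs_cont_on {a..b} f"
    unfolding f_def by (intro abs_cont_on_mult abs_cont_on_affine ac)
  have "abs_cont_on {a..b} F"
    unfolding F_def
    by (intro abs_cont_on_add abs_cont_on_mult abs_cont_on_affine abs_cont_on_const ac f_ac)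
  moreover have "(F has_real_derivative q x) (at x within {a..b})" if "x \<in> {a..b} - N" for x
    using \<psi>[of x] D[of x] that unfolding F_def f_def
    by (auto intro!: derivative_eq_intros simp: q_def power2_eq_square algebra_simps)
  ultimately have "(q has_integral (F b - F a)) {a..b}"
    using \<open>a \<le> b\<close> N by (intro abs_cont_on_fundamental_theorem)
  moreover have "(\<kappa> has_integral integral {a..b} \<kappa>) {a..b}"
    using \<kappa> by (rule integrable_integral)
  ultimately have "((\<lambda>x. q x + \<kappa> x) has_integral (F b - F a + integral {a..b} \<kappa>)) {a..b}"
    by (rule has_integral_add)
  \<comment> \<open>The open interval is used because \<open>bound\<close> is available only there:
    a sloped piece of the tent may take the values 0 or 1 at its ends.\<close>
  then have "((\<lambda>x. q x + \<kappa> x) has_integral (F b - F a + integral {a..b} \<kappa>)) {a<..<b}"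
    by (simp add: has_integral_Icc_iff_Ioo)
  then have "0 \<le> F b - F a + integral {a..b} \<kappa>"
  proof (rule has_integral_nonneg)
    fix x assume "x \<in> {a<..<b}"
    then have "m\<^sup>2 * (\<psi> x)\<^sup>2 + (c + m * x)\<^sup>2 * (E - V x) * (\<psi> x)\<^sup>2 \<le> \<kappa> x" by (rule bound)
    then show "0 \<le> q x + \<kappa> x"
      using zero_le_power2[of "m * \<psi> x + (c + m * x) * D x - k"] unfolding q_def by linarith
  qed
  moreover define G where "G = (c + m * b)\<^sup>2 * \<psi> b * D b - (c + m * a)\<^sup>2 * \<psi> a * D a"
  have "F b - F a = G - 2 * k * (f b - f a) + k * (k * (b - a))"
    by (simp add: F_def f_def G_def power2_eq_square algebra_simps)
  ultimately have "k * (f b - f a) \<le> G + integral {a..b} \<kappa>"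
    unfolding k by linarith
  then have "(b - a) * (k * (f b - f a)) \<le> (b - a) * (G + integral {a..b} \<kappa>)"
    using \<open>a < b\<close> by (intro mult_left_mono) auto
  moreover have "(b - a) * (k * (f b - f a)) = k * (b - a) * (f b - f a)" by simp
  then have "(b - a) * (k * (f b - f a)) = (f b - f a)\<^sup>2" by (simp only: k power2_eq_square)
  ultimately show ?thesis by (simp add: f_def G_def)
qed simp

text \<open>Cauchy--Schwarz for two terms: regrouping the four square roots bounds the cross term by
  \<open>p * B + q * A\<close>. This makes the bound on squared increments stable under
  concatenation.\<close>

lemma square_add_le:
  fixes x y p q A B :: real
  assumes x: "x\<^sup>2 \<le> p * A" and y: "y\<^sup>2 \<le> q * B" and "0 \<le> p" "0 \<le> q" "0 \<le> A" "0 \<le> B"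
  shows "(x + y)\<^sup>2 \<le> (p + q) * (A + B)"
proof -
  have "\<bar>x\<bar> \<le> sqrt (p * A)" "\<bar>y\<bar> \<le> sqrt (q * B)"
    using x y by (simp_all add: real_le_rsqrt)
  then have "\<bar>x\<bar> * \<bar>y\<bar> \<le> sqrt (p * A) * sqrt (q * B)"
    using assms by (intro mult_mono) auto
  also have "\<dots> = sqrt (p * B) * sqrt (q * A)" by (simp add: real_sqrt_mult)
  finally have "2 * (x * y) \<le> 2 * (sqrt (p * B) * sqrt (q * A))"
    using abs_ge_self[of "x * y"] by (simp add: abs_mult)
  also have "\<dots> \<le> p * B + q * A"
    using sum_squares_bound[of "sqrt (p * B)" "sqrt (q * A)"] assms by simp
  finally show ?thesis using x y by (simp add: power2_eq_square algebra_simps)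
qed

text \<open>Compactness replaces a list of the affine pieces of the tent. Both claims hold on affine
  pieces, pass to concatenations because \<Phi> is additive, and every point has an affine piece on
  each side; Bolzano's bisection principle then reaches all of \<open>{a..b}\<close>.\<close>

lemma tent_cutoff_energy:
  fixes \<psi> D V \<kappa> :: "real \<Rightarrow> real"
  defines "\<Phi> \<equiv> \<lambda>U l a b. (tent U l b)\<^sup>2 * \<psi> b * D b - (tent U l a)\<^sup>2 * \<psi> a * D a + integral {a..b} \<kappa>"
  assumes "a \<le> b" and l: "0 < l" and U: "closed U"
    and gap: "\<And>x y. x \<in> U \<Longrightarrow> y \<in> U \<Longrightarrow> x < y \<Longrightarrow> y - x < 2 * l \<Longrightarrow> {x..y} \<subseteq> U"
    and \<psi>: "\<And>x. x \<in> {a..b} \<Longrightarrow> (\<psi> has_real_derivative D x) (at x within {a..b})"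
    and ac: "abs_cont_on {a..b} \<psi>" "abs_cont_on {a..b} D"
    and N: "N \<in> null_sets lebesgue"
    and D: "\<And>x. x \<in> {a..b} - N \<Longrightarrow> (D has_real_derivative (V x - E) * \<psi> x) (at x within {a..b})"
    and \<kappa>: "\<kappa> integrable_on {a..b}" "\<And>x. x \<in> {a..b} \<Longrightarrow> 0 \<le> \<kappa> x"
    and supp: "\<And>x. x \<in> {a..b} \<Longrightarrow> 0 < tent U l x \<Longrightarrow> max (E - V x) 0 * (\<psi> x)\<^sup>2 \<le> \<kappa> x"
    and slope: "\<And>x. x \<in> {a..b} \<Longrightarrow> 0 < tent U l x \<Longrightarrow> tent U l x < 1 \<Longrightarrow>
      (\<psi> x)\<^sup>2 / l\<^sup>2 + max (E - V x) 0 * (\<psi> x)\<^sup>2 \<le> \<kappa> x"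
  shows "0 \<le> \<Phi> U l a b" "(tent U l b * \<psi> b - tent U l a * \<psi> a)\<^sup>2 \<le> (b - a) * \<Phi> U l a b"
proof -
  \<comment> \<open>The bounds \<open>a \<le> x\<close> and \<open>y \<le> b\<close> are premises
    inside \<open>P\<close>, so intervals that stick out of \<open>{a..b}\<close> are harmless in
    the local step of Bolzano's principle.\<close>
  define P where "P x y \<longleftrightarrow> (a \<le> x \<longrightarrow> y \<le> b \<longrightarrow> x \<le> y \<longrightarrow>
    0 \<le> \<Phi> U l x y \<and> (tent U l y * \<psi> y - tent U l x * \<psi> x)\<^sup>2 \<le> (y - x) * \<Phi> U l x y)" for x y
  have trans: "P x z" if xy: "P x y" and yz: "P y z" and le: "x \<le> y" "y \<le> z" for x y z
    unfolding P_def
  proof (intro impI)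
    assume xz: "a \<le> x" "z \<le> b" "x \<le> z"
    have "\<kappa> integrable_on {x..z}" by (rule integrable_on_subinterval[OF \<kappa>(1)]) (use xz in auto)
    then have "integral {x..z} \<kappa> = integral {x..y} \<kappa> + integral {y..z} \<kappa>"
      using le by (simp add: Henstock_Kurzweil_Integration.integral_combine)
    then have "\<Phi> U l x z = \<Phi> U l x y + \<Phi> U l y z" by (simp add: \<Phi>_def)
    then show "0 \<le> \<Phi> U l x z \<and> (tent U l z * \<psi> z - tent U l x * \<psi> x)\<^sup>2 \<le> (z - x) * \<Phi> U l x z"
      using square_add_le[of "tent U l y * \<psi> y - tent U l x * \<psi> x" "y - x" "\<Phi> U l x y"
          "tent U l z * \<psi> z - tent U l y * \<psi> y" "z - y" "\<Phi> U l y z"] xy yz le xz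
      by (auto simp: P_def)
  qed
  have affine: "P x y" if xy: "x \<le> y" and m: "m = 0 \<or> \<bar>m\<bar> = 1 / l"
    and eq: "\<And>s. s \<in> {x..y} \<Longrightarrow> tent U l s = c + m * s" for x y c m
    unfolding P_def
  proof (intro impI)
    assume "a \<le> x" "y \<le> b"
    then have sub: "{x..y} \<subseteq> {a..b}" by auto
    have "((c + m * y) * \<psi> y - (c + m * x) * \<psi> x)\<^sup>2 \<le>
      (y - x) * ((c + m * y)\<^sup>2 * \<psi> y * D y - (c + m * x)\<^sup>2 * \<psi> x * D x + integral {x..y} \<kappa>)"
    proof (rule affine_cutoff_energy[OF xy _ _ _ N])
      show "(\<psi> has_real_derivative D s) (at s within {x..y})" if "s \<in> {x..y}" for s
        using \<psi>[of s] that sub by (auto intro: DERIV_subset)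
      show "(D has_real_derivative (V s - E) * \<psi> s) (at s within {x..y})" if "s \<in> {x..y} - N" for s
        using D[of s] that sub by (auto intro: DERIV_subset)
      show "\<kappa> integrable_on {x..y}" by (rule integrable_on_subinterval[OF \<kappa>(1) sub])
      fix s assume s: "s \<in> {x<..<y}"
      have s_ab: "s \<in> {a..b}" using s sub by auto
      let ?h = "tent U l s"
      have h: "?h = c + m * s" "0 \<le> ?h" "?h \<le> 1" using eq[of s] s tent_nonneg[OF l, of U s] tent_le_1[OF l, of U s] by auto
      have "?h\<^sup>2 * ((E - V s) * (\<psi> s)\<^sup>2) \<le> ?h\<^sup>2 * (max (E - V s) 0 * (\<psi> s)\<^sup>2)"
        by (intro mult_left_mono mult_right_mono) auto
      also have "\<dots> \<le> 1 * (max (E - V s) 0 * (\<psi> s)\<^sup>2)"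
        using h by (intro mult_right_mono) (auto simp: power_le_one)
      finally have V: "?h\<^sup>2 * (E - V s) * (\<psi> s)\<^sup>2 \<le> max (E - V s) 0 * (\<psi> s)\<^sup>2" by (simp add: mult.assoc)
      show "m\<^sup>2 * (\<psi> s)\<^sup>2 + (c + m * s)\<^sup>2 * (E - V s) * (\<psi> s)\<^sup>2 \<le> \<kappa> s"
      proof (cases "m = 0")
        case True
        show ?thesis
        proof (cases "?h = 0")
          case True
          then show ?thesis using \<open>m = 0\<close> h(1) \<kappa>(2)[OF s_ab] by simp
        next
          case False
          then show ?thesis using \<open>m = 0\<close> h supp[OF s_ab] V by simp
        qed
      next
        case False
        \<comment> \<open>A nonconstant affine function with end values in [0, 1] is strictly
          between 0 and 1 inside, which is what \<open>slope\<close> asks for.\<close>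
        have ends: "0 \<le> c + m * x" "c + m * x \<le> 1" "0 \<le> c + m * y" "c + m * y \<le> 1"
          using eq[of x] eq[of y] xy l tent_nonneg[of l U x] tent_le_1[of l U x]
            tent_nonneg[of l U y] tent_le_1[of l U y] by auto
        have "0 < ?h \<and> ?h < 1"
        proof (cases "0 < m")
          case True
          then have "m * x < m * s" "m * s < m * y" using s by auto
          then show ?thesis using ends h(1) by linarith
        next
          case False
          then have "m * s < m * x" "m * y < m * s" using s \<open>m \<noteq> 0\<close> by auto
          then show ?thesis using ends h(1) by linarith
        qed
        moreover have "m\<^sup>2 = 1 / l\<^sup>2" using False m by (metis power2_abs power_one_over)
        ultimately show ?thesis using slope[OF s_ab] V h(1) by (simp add: algebra_simps)
      qed
    qed (use abs_cont_on_subset[OF _ sub] ac in auto)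
    then have "(tent U l y * \<psi> y - tent U l x * \<psi> x)\<^sup>2 \<le> (y - x) * \<Phi> U l x y"
      using eq xy by (simp add: \<Phi>_def)
    moreover from this have "0 \<le> \<Phi> U l x y"
    proof (cases "x = y")
      case False
      then have "0 < y - x" using xy by simp
      moreover have "0 \<le> (y - x) * \<Phi> U l x y"
        using order_trans[OF zero_le_power2 \<open>_ \<le> (y - x) * \<Phi> U l x y\<close>] .
      ultimately show ?thesis by (simp add: zero_le_mult_iff)
    qed (simp add: \<Phi>_def)
    ultimately show "0 \<le> \<Phi> U l x y \<and> (tent U l y * \<psi> y - tent U l x * \<psi> x)\<^sup>2 \<le> (y - x) * \<Phi> U l x y" by blast
  qed
  have "P a b"
  proof (rule Bolzano[OF \<open>a \<le> b\<close>])
    fix t assume "a \<le> t" "t \<le> b"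
    obtain d1 c1 m1 where 1: "d1 > 0" "m1 = 0 \<or> \<bar>m1\<bar> = 1 / l"
      "\<And>s. s \<in> {t..t + d1} \<Longrightarrow> tent U l s = c1 + m1 * s"
      using tent_affine_right[OF l U gap, of t] by blast
    obtain d2 c2 m2 where 2: "d2 > 0" "m2 = 0 \<or> \<bar>m2\<bar> = 1 / l"
      "\<And>s. s \<in> {t - d2..t} \<Longrightarrow> tent U l s = c2 + m2 * s"
      using tent_affine_left[OF l U gap, of t] by blast
    have "P x y" if "x \<le> t" "t \<le> y" "y - x < min d1 d2" for x y
    proof (rule trans)
      show "P x t" using that by (intro affine[OF _ 2(2) 2(3)]) auto
      show "P t y" using that by (intro affine[OF _ 1(2) 1(3)]) auto
    qed (use that in auto)
    then show "\<exists>d>0. \<forall>x y. x \<le> t \<and> t \<le> y \<and> y - x < d \<longrightarrow> P x y"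
      using 1(1) 2(1) by (intro exI[of _ "min d1 d2"]) auto
  qed (fact trans)
  then show "0 \<le> \<Phi> U l a b" "(tent U l b * \<psi> b - tent U l a * \<psi> a)\<^sup>2 \<le> (b - a) * \<Phi> U l a b"
    using \<open>a \<le> b\<close> by (auto simp: P_def)
qed

text \<open>The embedding of W^{1,1} into bounded functions with an explicit constant: |h(s)| is at
  most |h(t)| plus the integral of |h'|, and this is averaged over \<open>t\<close>. One majorant
  \<open>p\<close> serves for both \<open>h\<close> and its derivative.\<close>

lemma abs_le_integral_of_bound:
  fixes h q p :: "real \<Rightarrow> real"
  assumes "a < b" and ac: "abs_cont_on {a..b} h" and N: "N \<in> null_sets lebesgue"
    and der: "\<And>x. x \<in> {a..b} - N \<Longrightarrow> (h has_real_derivative q x) (at x within {a..b})"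
    and p: "p integrable_on {a..b}" "\<And>x. x \<in> {a..b} \<Longrightarrow> \<bar>h x\<bar> \<le> p x" "\<And>x. x \<in> {a..b} \<Longrightarrow> \<bar>q x\<bar> \<le> p x"
    and s: "s \<in> {a..b}"
  shows "\<bar>h s\<bar> \<le> (1 / (b - a) + 1) * integral {a..b} p"
proof -
  let ?I = "integral {a..b} p"
  have p0: "0 \<le> p x" if "x \<in> {a..b}" for x using p(2)[OF that] by linarith
  have diff: "\<bar>h v - h u\<bar> \<le> ?I" if uv: "u \<le> v" "a \<le> u" "v \<le> b" for u v
  proof -
    have sub: "{u..v} \<subseteq> {a..b}" using uv by auto
    have "(h has_real_derivative q x) (at x within {u..v})" if "x \<in> {u..v} - N" for x
      using der[of x] sub that by (auto intro: DERIV_subset)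
    then have q: "(q has_integral (h v - h u)) {u..v}"
      by (rule abs_cont_on_fundamental_theorem[OF uv(1) abs_cont_on_subset[OF ac sub] N])
    have pi: "p integrable_on {u..v}" by (rule integrable_on_subinterval[OF p(1) sub])
    have "norm (integral {u..v} q) \<le> integral {u..v} p"
      using q p(3) sub by (intro integral_norm_bound_integral pi) auto
    also have "\<dots> \<le> ?I"
      using p0 by (intro integral_subset_le[OF sub pi p(1)]) auto
    finally show ?thesis using integral_unique[OF q] by simp
  qed
  have "\<bar>h s\<bar> - ?I \<le> p t" if t: "t \<in> {a..b}" for t
    using diff[of s t] diff[of t s] p(2)[OF t] s t by (cases "s \<le> t") auto
  then have "integral {a..b} (\<lambda>t. \<bar>h s\<bar> - ?I) \<le> ?I"
    by (intro integral_le p(1) integrable_const_ivl) auto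
  then have "(b - a) * \<bar>h s\<bar> \<le> ?I + (b - a) * ?I"
    using \<open>a < b\<close> by (simp add: algebra_simps)
  then show ?thesis using \<open>a < b\<close> by (simp add: field_simps)
qed

section \<open>Integrals with respect to arc length\<close>

context metric_graph
begin

lemma measurable_pt:
  assumes "e \<in> edges G"
  shows "pt G e \<in> measurable (restrict_space lebesgue (edge_ivl G e)) (arc_length G)"
proof (rule measurableI)
  fix A assume "A \<in> sets (arc_length G)"
  then have "{t \<in> edge_ivl G e. pt G e t \<in> A} \<in> sets lebesgue" using assms by (simp add: sets_arc_length)
  moreover have "pt G e -` A \<inter> space (restrict_space lebesgue (edge_ivl G e)) = {t \<in> edge_ivl G e. pt G e t \<in> A}"
    by (auto simp: space_restrict_space)
  ultimately show "pt G e -` A \<inter> space (restrict_space lebesgue (edge_ivl G e))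
      \<in> sets (restrict_space lebesgue (edge_ivl G e))"
    using edge_ivl_lebesgue by (subst sets_restrict_space_iff) auto
qed (use assms pt_in_points in \<open>auto simp: space_arc_length space_restrict_space\<close>)

lemma measurable_edge:
  fixes u :: "('v, 'e) gpoint \<Rightarrow> ennreal"
  assumes "u \<in> borel_measurable (arc_length G)" "e \<in> edges G"
  shows "(\<lambda>t. u (pt G e t) * indicator (edge_ivl G e) t) \<in> borel_measurable lebesgue"
  using measurable_compose[OF measurable_pt[OF assms(2)] assms(1)] edge_ivl_lebesgue
  by (subst (asm) borel_measurable_restrict_space_iff_ennreal) auto

text \<open>Indicators give the definition of the measure; monotone convergence, used once on each
  edge and once for the counting measure, does the rest.\<close>

lemma nn_integral_arc_length:
  assumes "u \<in> borel_measurable (arc_length G)"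
  shows "(\<integral>\<^sup>+ x. u x \<partial>arc_length G) =
    (\<integral>\<^sup>+ e. (\<integral>\<^sup>+ t. u (pt G e t) * indicator (edge_ivl G e) t \<partial>lebesgue) \<partial>count_space (edges G))"
  using assms
proof (induction rule: borel_measurable_induct)
  case (cong f g)
  have "(\<integral>\<^sup>+ x. f x \<partial>arc_length G) = (\<integral>\<^sup>+ x. g x \<partial>arc_length G)"
    using cong by (intro nn_integral_cong) auto
  moreover have "f (pt G e t) * indicator (edge_ivl G e) t = g (pt G e t) * indicator (edge_ivl G e) t"
    if "e \<in> edges G" for e t
    using cong(3) pt_in_points[OF that] by (auto simp: space_arc_length split: split_indicator)
  ultimately show ?case using cong(4) by (simp cong: nn_integral_cong_simp)
next
  case (set A)
  have "(\<integral>\<^sup>+ t. indicator A (pt G e t) * indicator (edge_ivl G e) t \<partial>lebesgue) =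
      emeasure lebesgue {t \<in> edge_ivl G e. pt G e t \<in> A}" if "e \<in> edges G" for e
  proof -
    have "(\<integral>\<^sup>+ t. indicator A (pt G e t) * indicator (edge_ivl G e) t \<partial>lebesgue) =
       (\<integral>\<^sup>+ t. indicator {t \<in> edge_ivl G e. pt G e t \<in> A} t \<partial>lebesgue)"
      by (intro nn_integral_cong) (auto split: split_indicator)
    also have "\<dots> = emeasure lebesgue {t \<in> edge_ivl G e. pt G e t \<in> A}"
      using set that by (intro nn_integral_indicator) (simp add: sets_arc_length)
    finally show ?thesis .
  qed
  then show ?case using set by (simp add: emeasure_arc_length cong: nn_integral_cong_simp)
next
  case (mult u c)
  have "(\<integral>\<^sup>+ t. c * u (pt G e t) * indicator (edge_ivl G e) t \<partial>lebesgue) =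
      c * (\<integral>\<^sup>+ t. u (pt G e t) * indicator (edge_ivl G e) t \<partial>lebesgue)" if "e \<in> edges G" for e
    using measurable_edge[OF mult(2) that] by (simp add: mult.assoc nn_integral_cmult)
  then show ?case using mult by (simp add: nn_integral_cmult cong: nn_integral_cong_simp)
next
  case (add u v)
  have "(\<integral>\<^sup>+ t. (v (pt G e t) + u (pt G e t)) * indicator (edge_ivl G e) t \<partial>lebesgue) =
      (\<integral>\<^sup>+ t. v (pt G e t) * indicator (edge_ivl G e) t \<partial>lebesgue) +
      (\<integral>\<^sup>+ t. u (pt G e t) * indicator (edge_ivl G e) t \<partial>lebesgue)" if "e \<in> edges G" for e
    using measurable_edge[OF add(1) that] measurable_edge[OF add(3) that]
    by (simp add: distrib_right nn_integral_add)
  then show ?case using add by (simp add: nn_integral_add cong: nn_integral_cong_simp)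
next
  case (seq U)
  have "(\<integral>\<^sup>+ t. (SUP i. U i) (pt G e t) * indicator (edge_ivl G e) t \<partial>lebesgue) =
      (SUP i. \<integral>\<^sup>+ t. U i (pt G e t) * indicator (edge_ivl G e) t \<partial>lebesgue)" if "e \<in> edges G" for e
  proof -
    have "(\<integral>\<^sup>+ t. (SUP i. U i) (pt G e t) * indicator (edge_ivl G e) t \<partial>lebesgue) =
      (\<integral>\<^sup>+ t. (SUP i. U i (pt G e t) * indicator (edge_ivl G e) t) \<partial>lebesgue)"
      by (intro nn_integral_cong) (auto simp: SUP_apply image_comp split: split_indicator)
    also have "\<dots> = (SUP i. \<integral>\<^sup>+ t. U i (pt G e t) * indicator (edge_ivl G e) t \<partial>lebesgue)"
    proof (rule nn_integral_monotone_convergence_SUP)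
      show "incseq (\<lambda>i t. U i (pt G e t) * indicator (edge_ivl G e) t)"
        using seq(3) by (auto simp: incseq_def le_fun_def intro!: mult_right_mono)
    qed (use measurable_edge[OF seq(1) that] in auto)
    finally show ?thesis .
  qed
  moreover have "(\<integral>\<^sup>+ e. (SUP i. \<integral>\<^sup>+ t. U i (pt G e t) * indicator (edge_ivl G e) t \<partial>lebesgue) \<partial>count_space (edges G))
     = (SUP i. \<integral>\<^sup>+ e. (\<integral>\<^sup>+ t. U i (pt G e t) * indicator (edge_ivl G e) t \<partial>lebesgue) \<partial>count_space (edges G))"
    using seq(3) by (intro nn_integral_monotone_convergence_SUP)
      (auto simp: incseq_def le_fun_def intro!: nn_integral_mono mult_right_mono)
  moreover have "(\<integral>\<^sup>+ x. (SUP i. U i) x \<partial>arc_length G) = (SUP i. \<integral>\<^sup>+ x. U i x \<partial>arc_length G)"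
    using nn_integral_monotone_convergence_SUP[OF seq(3) seq(1)] by (simp add: SUP_apply image_comp)
  ultimately show ?case using seq(4) by (simp add: seq.IH cong: nn_integral_cong_simp)
qed

text \<open>Nonnegativity bounds the share of every finite family of edges by the total integral.
  Finite families suffice, since later sums over all edges are controlled through their finite
  partial sums.\<close>

lemma arc_length_integral_edges:
  assumes u: "integrable (arc_length G) u" "\<And>x. x \<in> points G \<Longrightarrow> (0::real) \<le> u x"
  shows absolutely_integrable_edge: "e \<in> edges G \<Longrightarrow> (\<lambda>t. u (pt G e t)) absolutely_integrable_on edge_ivl G e"
    and sum_integral_edges_le: "finite F \<Longrightarrow> F \<subseteq> edges G \<Longrightarrow>
      (\<Sum>e\<in>F. integral (edge_ivl G e) (\<lambda>t. u (pt G e t))) \<le> integral\<^sup>L (arc_length G) u"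
proof -
  have um: "u \<in> borel_measurable (arc_length G)" using u(1) by simp
  have eq: "ennreal (u (pt G e t)) * indicator (edge_ivl G e) t
      = ennreal (indicator (edge_ivl G e) t *\<^sub>R u (pt G e t))" for e t
    by (auto split: split_indicator)
  have total: "ennreal (integral\<^sup>L (arc_length G) u) =
    (\<integral>\<^sup>+ e. (\<integral>\<^sup>+ t. ennreal (u (pt G e t)) * indicator (edge_ivl G e) t \<partial>lebesgue) \<partial>count_space (edges G))"
    using u um nn_integral_arc_length[of "\<lambda>x. ennreal (u x)"]
    by (subst nn_integral_eq_integral[symmetric]) (auto simp: space_arc_length intro!: AE_I2)
  have edge_fin: "(\<integral>\<^sup>+ t. ennreal (u (pt G e t)) * indicator (edge_ivl G e) t \<partial>lebesgue) < \<infinity>" if "e \<in> edges G" for e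
  proof -
    have "(\<integral>\<^sup>+ t. ennreal (u (pt G e t)) * indicator (edge_ivl G e) t \<partial>lebesgue)
      \<le> (\<integral>\<^sup>+ e. (\<integral>\<^sup>+ t. ennreal (u (pt G e t)) * indicator (edge_ivl G e) t \<partial>lebesgue) \<partial>count_space (edges G))"
      using that by (rule nn_integral_ge_point)
    also have "\<dots> < \<infinity>" unfolding total[symmetric] by simp
    finally show ?thesis .
  qed
  have abs: "(\<lambda>t. u (pt G e t)) absolutely_integrable_on edge_ivl G e" if e: "e \<in> edges G" for e
    unfolding set_integrable_def
  proof (rule integrableI_bounded)
    have "u \<circ> pt G e \<in> borel_measurable (restrict_space lebesgue (edge_ivl G e))"
      using measurable_comp[OF measurable_pt[OF e] um] .
    then show "(\<lambda>t. indicator (edge_ivl G e) t *\<^sub>R u (pt G e t)) \<in> borel_measurable lebesgue"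
      using edge_ivl_lebesgue by (subst (asm) borel_measurable_restrict_space_iff) (auto simp: o_def)
    have "(\<integral>\<^sup>+ t. ennreal (norm (indicator (edge_ivl G e) t *\<^sub>R u (pt G e t))) \<partial>lebesgue)
      = (\<integral>\<^sup>+ t. ennreal (u (pt G e t)) * indicator (edge_ivl G e) t \<partial>lebesgue)"
      using u(2) pt_in_points[OF e] by (intro nn_integral_cong) (auto split: split_indicator)
    then show "(\<integral>\<^sup>+ t. ennreal (norm (indicator (edge_ivl G e) t *\<^sub>R u (pt G e t))) \<partial>lebesgue) < \<infinity>"
      using edge_fin[OF e] by simp
  qed
  then show "e \<in> edges G \<Longrightarrow> (\<lambda>t. u (pt G e t)) absolutely_integrable_on edge_ivl G e" .
  have edge: "(\<integral>\<^sup>+ t. ennreal (u (pt G e t)) * indicator (edge_ivl G e) t \<partial>lebesgue)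
    = ennreal (integral (edge_ivl G e) (\<lambda>t. u (pt G e t)))" if e: "e \<in> edges G" for e
  proof -
    have "(\<integral>\<^sup>+ t. ennreal (u (pt G e t)) * indicator (edge_ivl G e) t \<partial>lebesgue)
      = ennreal (LINT t|lebesgue. indicator (edge_ivl G e) t *\<^sub>R u (pt G e t))"
      unfolding eq using abs[OF e] u(2) pt_in_points[OF e]
      by (intro nn_integral_eq_integral AE_I2) (auto simp: set_integrable_def split: split_indicator)
    then show ?thesis
      using set_lebesgue_integral_eq_integral(2)[OF abs[OF e]] by (simp add: set_lebesgue_integral_def)
  qed
  have nonneg: "0 \<le> integral (edge_ivl G e) (\<lambda>t. u (pt G e t))" if "e \<in> edges G" for e
    using abs[OF that] u(2) pt_in_points[OF that]
    by (intro Henstock_Kurzweil_Integration.integral_nonneg) (auto simp: absolutely_integrable_on_def)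
  assume F: "finite F" "F \<subseteq> edges G"
  have "ennreal (\<Sum>e\<in>F. integral (edge_ivl G e) (\<lambda>t. u (pt G e t)))
    = (\<Sum>e\<in>F. \<integral>\<^sup>+ t. ennreal (u (pt G e t)) * indicator (edge_ivl G e) t \<partial>lebesgue)"
    using F nonneg edge by (subst sum_ennreal[symmetric]) (auto intro!: sum.cong)
  also have "\<dots> = (\<integral>\<^sup>+ e. (\<integral>\<^sup>+ t. ennreal (u (pt G e t)) * indicator (edge_ivl G e) t \<partial>lebesgue) * indicator F e
      \<partial>count_space (edges G))"
    using F by (subst nn_integral_count_space'[of F]) (auto intro!: sum.cong)
  also have "\<dots> \<le> ennreal (integral\<^sup>L (arc_length G) u)"
    unfolding total by (intro nn_integral_mono) (auto split: split_indicator)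
  finally show "(\<Sum>e\<in>F. integral (edge_ivl G e) (\<lambda>t. u (pt G e t))) \<le> integral\<^sup>L (arc_length G) u"
    using u(2) by (subst (asm) ennreal_le_iff) (auto simp: space_arc_length intro!: integral_nonneg_AE AE_I2)
qed

end

section \<open>Topology of a metric graph\<close>

context metric_graph
begin

lemma closed_edge_ivl: "closed (edge_ivl G e)"
  unfolding edge_ivl_def
  by (intro closed_Collect_conj closed_Collect_le continuous_intros continuous_on_ereal)

lemma edge_ivl_between: "s \<in> edge_ivl G e \<Longrightarrow> t \<in> edge_ivl G e \<Longrightarrow> s \<le> x \<Longrightarrow> x \<le> t \<Longrightarrow> x \<in> edge_ivl G e"
  unfolding edge_ivl_def by (auto intro: order_trans simp flip: ereal_less_eq(3))

lemma Icc_subset_edge_ivl: "s \<in> edge_ivl G e \<Longrightarrow> t \<in> edge_ivl G e \<Longrightarrow> {s..t} \<subseteq> edge_ivl G e"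
  using edge_ivl_between[of s e t] by (simp add: subset_iff)

lemma connected_edge_ivl: "connected (edge_ivl G e)"
  unfolding connected_iff_interval by (auto intro: edge_ivl_between[of _ e])

text \<open>An edge is connected and has two points, hence no isolated ones. This makes derivatives
  within the edge unique, also at its ends.\<close>

lemma at_within_edge_ivl_neq_bot:
  assumes "e \<in> edges G" "t \<in> edge_ivl G e"
  shows "at t within edge_ivl G e \<noteq> bot"
proof -
  obtain x where x: "lo G e < ereal x" "ereal x < hi G e" using ereal_dense2[OF lo_less_hi[OF assms(1)]] by blast
  obtain y where y: "ereal x < ereal y" "ereal y < hi G e" using ereal_dense2[OF x(2)] by blast
  have "x \<in> edge_ivl G e" "y \<in> edge_ivl G e" "x \<noteq> y"
    using x y less_trans[OF x(1) y(1)] by (auto simp: edge_ivl_def less_imp_le)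
  then have "\<not> (\<exists>a. edge_ivl G e = {a})" by auto
  then show ?thesis
    using connected_imp_perfect[OF connected_edge_ivl, of t e] assms by (simp add: trivial_limit_within)
qed

lemma lo_real: "e \<in> edges G \<Longrightarrow> lo G e \<noteq> -\<infinity> \<Longrightarrow> ereal (real_of_ereal (lo G e)) = lo G e"
  using lo_less_hi[of e] by (cases "lo G e") auto

lemma hi_real: "e \<in> edges G \<Longrightarrow> hi G e \<noteq> \<infinity> \<Longrightarrow> ereal (real_of_ereal (hi G e)) = hi G e"
  using lo_less_hi[of e] by (cases "hi G e") auto

lemma lo_end:
  assumes "e \<in> edges G" "lo G e \<noteq> -\<infinity>"
  shows lo_in_edge_ivl: "real_of_ereal (lo G e) \<in> edge_ivl G e"
    and pt_lo: "pt G e (real_of_ereal (lo G e)) = Vertex (src G e)"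
    and lo_le: "t \<in> edge_ivl G e \<Longrightarrow> real_of_ereal (lo G e) \<le> t"
  using lo_real[OF assms] lo_less_hi[OF assms(1)]
  by (auto simp: edge_ivl_def pt_def less_imp_le simp flip: ereal_less_eq(3))

lemma hi_end:
  assumes "e \<in> edges G" "hi G e \<noteq> \<infinity>"
  shows hi_in_edge_ivl: "real_of_ereal (hi G e) \<in> edge_ivl G e"
    and pt_hi: "pt G e (real_of_ereal (hi G e)) = Vertex (tgt G e)"
    and le_hi: "t \<in> edge_ivl G e \<Longrightarrow> t \<le> real_of_ereal (hi G e)"
  using hi_real[OF assms] lo_less_hi[OF assms(1)]
  by (auto simp: edge_ivl_def pt_def less_imp_le simp flip: ereal_less_eq(3))

lemma atLeast_subset_edge_ivl: "hi G e = \<infinity> \<Longrightarrow> t \<in> edge_ivl G e \<Longrightarrow> {t..} \<subseteq> edge_ivl G e"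
  unfolding edge_ivl_def by (auto intro: order_trans simp flip: ereal_less_eq(3))

lemma atMost_subset_edge_ivl: "lo G e = -\<infinity> \<Longrightarrow> t \<in> edge_ivl G e \<Longrightarrow> {..t} \<subseteq> edge_ivl G e"
  unfolding edge_ivl_def by (auto intro: order_trans simp flip: ereal_less_eq(3))

lemma points_cases:
  assumes "x \<in> points G"
  obtains (vertex) v where "v \<in> verts G" "x = Vertex v"
    | (inner) e t where "e \<in> edges G" "t \<in> edge_ivl G e" "x = Inner e t" "x = pt G e t"
proof -
  consider v where "v \<in> verts G" "x = Vertex v"
    | e t where "e \<in> edges G" "lo G e < ereal t" "ereal t < hi G e" "x = Inner e t"
    using assms unfolding points_def by blast
  then show thesis
  proof cases
    case 2
    then have "t \<in> edge_ivl G e" "x = pt G e t" by (auto simp: edge_ivl_def pt_def)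
    then show thesis using inner 2 by blast
  qed (fact vertex)
qed

end

locale metric_graph_space = metric_graph G for G :: "('v, 'e) mgraph" +
  fixes Lmin :: real
  assumes Lmin: "0 < Lmin" "edge_length_ge G Lmin" and connected: "connected_graph G"
begin

sublocale gm: Metric_space "points G" "gdist G"
  by (rule Metric_space_gdist[OF Lmin connected])

lemma topspace_gtop: "topspace (gtop G) = points G"
  by (simp add: gtop_def)

text \<open>The parametrization of an edge is 1-Lipschitz, because a segment of the edge is itself a
  route.\<close>

lemma continuous_map_pt:
  assumes e: "e \<in> edges G"
  shows "continuous_map (top_of_set (edge_ivl G e)) (gtop G) (pt G e)"
  unfolding continuous_map_def
proof (intro conjI allI impI)
  show "pt G e \<in> topspace (top_of_set (edge_ivl G e)) \<rightarrow> topspace (gtop G)"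
    using pt_in_points[OF e] by (auto simp: topspace_gtop)
  fix A assume "openin (gtop G) A"
  then have A: "\<And>x. x \<in> A \<Longrightarrow> \<exists>r>0. gm.mball x r \<subseteq> A"
    by (simp add: gtop_def gm.openin_mtopology)
  have "\<exists>r>0. \<forall>s\<in>edge_ivl G e. dist s t < r \<longrightarrow> pt G e s \<in> A"
    if t: "t \<in> edge_ivl G e" "pt G e t \<in> A" for t
  proof -
    obtain r where r: "r > 0" "gm.mball (pt G e t) r \<subseteq> A" using A t(2) by blast
    have "pt G e s \<in> A" if "s \<in> edge_ivl G e" "dist s t < r" for s
    proof -
      have "gdist G (pt G e t) (pt G e s) < r"
        using gdist_edge_le[OF e t(1) that(1)] that(2) by (simp add: dist_real_def abs_minus_commute)
      then have "pt G e s \<in> gm.mball (pt G e t) r" using pt_in_points e t(1) that(1) by simp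
      then show ?thesis using r(2) by blast
    qed
    then show ?thesis using r(1) by blast
  qed
  then show "openin (top_of_set (edge_ivl G e)) {x \<in> topspace (top_of_set (edge_ivl G e)). pt G e x \<in> A}"
    by (auto simp: openin_euclidean_subtopology_iff)
qed

lemma openin_sets_arc_length:
  assumes "openin (gtop G) A"
  shows "A \<in> sets (arc_length G)"
proof -
  have "{t \<in> edge_ivl G e. pt G e t \<in> A} \<in> sets lebesgue" if "e \<in> edges G" for e
  proof -
    have "openin (top_of_set (edge_ivl G e)) {t \<in> edge_ivl G e. pt G e t \<in> A}"
      using openin_continuous_map_preimage[OF continuous_map_pt[OF that] assms] by simp
    then obtain T where "open T" "{t \<in> edge_ivl G e. pt G e t \<in> A} = edge_ivl G e \<inter> T"
      by (auto simp: openin_open)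
    moreover have "edge_ivl G e \<inter> T \<in> sets lebesgue"
      using \<open>open T\<close> by (intro sets.Int edge_ivl_lebesgue) auto
    ultimately show ?thesis by simp
  qed
  then show ?thesis using openin_subset[OF assms] by (simp add: sets_arc_length topspace_gtop)
qed

lemma bdd_below_gdist: "bdd_below (gdist G x ` S)"
  by (rule bdd_belowI[of _ 0]) (auto simp: gdist_nonneg)

lemma gdist_set_le: "y \<in> S \<Longrightarrow> gdist_set G x S \<le> gdist G x y"
  unfolding gdist_set_def using bdd_below_gdist by (rule cINF_lower)

lemma gdist_set_triangle:
  assumes "x \<in> points G" "y \<in> points G" "S \<subseteq> points G" "S \<noteq> {}"
  shows "gdist_set G x S \<le> gdist G x y + gdist_set G y S"
proof -
  have "gdist_set G x S - gdist G x y \<le> gdist G y z" if "z \<in> S" for z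
    using gdist_set_le[OF that, of x] gdist_triangle[OF connected, of x y z] assms that by force
  then have "gdist_set G x S - gdist G x y \<le> gdist_set G y S"
    unfolding gdist_set_def[of G y] using assms(4) by (intro cINF_greatest) auto
  then show ?thesis by simp
qed

lemma openin_gdist_set_gt:
  assumes S: "S \<subseteq> points G" "S \<noteq> {}"
  shows "openin (gtop G) {x \<in> points G. r < gdist_set G x S}"
  unfolding gtop_def gm.openin_mtopology
proof (intro conjI allI impI)
  fix x assume x: "x \<in> {x \<in> points G. r < gdist_set G x S}"
  have "r < gdist_set G y S" if "y \<in> gm.mball x (gdist_set G x S - r)" for y
    using gdist_set_triangle[OF _ _ S, of x y] that by auto
  then show "\<exists>d>0. gm.mball x d \<subseteq> {x \<in> points G. r < gdist_set G x S}"
    using x by (intro exI[of _ "gdist_set G x S - r"]) auto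
qed auto

text \<open>The segment is connected and meets both \<open>W\<close> and its complement, so it meets
  the frontier. This links distances along an edge, from which the cutoff is built, to distances in
  the graph.\<close>

lemma gdist_set_frontier_le:
  assumes e: "e \<in> edges G" and st: "s \<in> edge_ivl G e" "t \<in> edge_ivl G e"
    and W: "pt G e s \<in> W" "pt G e t \<notin> W"
  shows "gdist_set G (pt G e s) (gtop G frontier_of W) \<le> \<bar>s - t\<bar>"
proof -
  have sub: "closed_segment s t \<subseteq> edge_ivl G e"
    using Icc_subset_edge_ivl[OF st] Icc_subset_edge_ivl[OF st(2,1)] by (auto simp: closed_segment_eq_real_ivl)
  have "connectedin (gtop G) (pt G e ` closed_segment s t)"
    using sub by (intro connectedin_continuous_map_image[OF continuous_map_pt[OF e]])
      (simp add: connectedin_subtopology)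
  then have "pt G e ` closed_segment s t \<inter> gtop G frontier_of W \<noteq> {}"
    using W by (intro connectedin_Int_frontier_of) auto
  then obtain u where u: "u \<in> closed_segment s t" "pt G e u \<in> gtop G frontier_of W" by blast
  have "gdist_set G (pt G e s) (gtop G frontier_of W) \<le> gdist G (pt G e s) (pt G e u)"
    by (rule gdist_set_le[OF u(2)])
  also have "\<dots> \<le> \<bar>s - u\<bar>" using e st(1) u(1) sub by (intro gdist_edge_le) auto
  also have "\<dots> \<le> \<bar>s - t\<bar>" using u(1) by (auto simp: closed_segment_eq_real_ivl split: if_splits)
  finally show ?thesis .
qed

end

section \<open>The cutoff attached to a region\<close>

locale graph_region = metric_graph_space G Lmin for G :: "('v, 'e) mgraph" and Lmin :: real +
  fixes W :: "('v, 'e) gpoint set" and l :: real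
  assumes W: "openin (gtop G) W" "gtop G frontier_of W \<noteq> {}" and l: "0 < l"
    and no_vertex: "\<forall>v\<in>verts G. Vertex v \<notin> boundary_strip G W l"
begin

abbreviation bdist :: "('v, 'e) gpoint \<Rightarrow> real" where
  "bdist x \<equiv> gdist_set G x (gtop G frontier_of W)"

abbreviation B :: "('v, 'e) gpoint set" where
  "B \<equiv> boundary_strip G W l"

lemma W_subset: "W \<subseteq> points G"
  using openin_subset[OF W(1)] by (simp add: topspace_gtop)

lemma frontier_disjoint: "x \<in> gtop G frontier_of W \<Longrightarrow> x \<in> points G \<and> x \<notin> W"
  using W(1) frontier_of_subset_topspace[of "gtop G" W]
  by (auto simp: frontier_of_def interior_of_openin topspace_gtop)

lemma W_sets: "W \<in> sets (arc_length G)"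
  by (rule openin_sets_arc_length[OF W(1)])

lemma B_sets: "B \<in> sets (arc_length G)"
proof -
  have "B = W - {x \<in> points G. l < bdist x}"
    using W_subset by (auto simp: boundary_strip_def)
  moreover have "{x \<in> points G. l < bdist x} \<in> sets (arc_length G)"
    using frontier_disjoint W(2) by (intro openin_sets_arc_length openin_gdist_set_gt) auto
  ultimately show ?thesis using W_sets by simp
qed

text \<open>The cutoff is built from distances along the edge to the set \<open>core\<close>, not from the distance to
  the frontier: it vanishes on components of \<open>W\<close> of length less than \<open>2 * l\<close> inside an edge, so it has
  locally finitely many affine pieces even if \<open>W\<close> has infinitely many components there.\<close>

definition core :: "'e \<Rightarrow> real set" where
  "core e = {t \<in> edge_ivl G e. \<forall>c\<in>edge_ivl G e. pt G e c \<notin> W \<longrightarrow> l \<le> \<bar>t - c\<bar>}"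

abbreviation cutoff :: "'e \<Rightarrow> real \<Rightarrow> real" where
  "cutoff e \<equiv> tent (core e) l"

lemma closed_core: "closed (core e)"
proof -
  have "core e = edge_ivl G e \<inter> (\<Inter>c\<in>{c \<in> edge_ivl G e. pt G e c \<notin> W}. {t. l \<le> \<bar>t - c\<bar>})"
    by (auto simp: core_def)
  also have "closed \<dots>"
    by (intro closed_Int closed_edge_ivl closed_INT ballI closed_Collect_le continuous_intros)
  finally show ?thesis .
qed

text \<open>Two points at distance less than \<open>2 * l\<close> leave no room between them for a
  point that is at least \<open>l\<close> away from both, so every excluded point lies outside
  \<open>{x..y}\<close>.\<close>

lemma core_gap:
  assumes "x \<in> core e" "y \<in> core e" "x < y" "y - x < 2 * l"
  shows "{x..y} \<subseteq> core e"
proof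
  fix z assume z: "z \<in> {x..y}"
  have "l \<le> \<bar>z - c\<bar>" if "c \<in> edge_ivl G e" "pt G e c \<notin> W" for c
  proof -
    have "l \<le> \<bar>x - c\<bar>" "l \<le> \<bar>y - c\<bar>" using assms that by (auto simp: core_def)
    then show ?thesis using z assms(3,4) by auto
  qed
  moreover have "z \<in> edge_ivl G e"
    using assms z edge_ivl_between[of x e y z] by (auto simp: core_def)
  ultimately show "z \<in> core e" by (simp add: core_def)
qed

text \<open>Tents reach strictly less far than \<open>l\<close> from \<open>core\<close>, while the
  complement of \<open>W\<close> keeps at least that distance.\<close>

lemma cutoff_pos_imp_W:
  assumes "t \<in> edge_ivl G e" "0 < cutoff e t"
  shows "pt G e t \<in> W"
proof (rule ccontr)
  assume notW: "pt G e t \<notin> W"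
  obtain u where "u \<in> core e" "\<bar>t - u\<bar> < l" using tent_posD[OF l assms(2)] .
  then show False using notW assms(1) by (force simp: core_def abs_minus_commute)
qed

text \<open>Outside \<open>core\<close> some point of the edge not in \<open>W\<close> is closer
  than \<open>l\<close>, hence so is the frontier. This confines the slope of the cutoff to the
  strip.\<close>

lemma cutoff_less_1_imp_B:
  assumes "e \<in> edges G" "t \<in> edge_ivl G e" "pt G e t \<in> W" "cutoff e t < 1"
  shows "pt G e t \<in> B"
proof -
  have "t \<notin> core e" using tent_eq_1[OF l] assms(4) by force
  then obtain c where c: "c \<in> edge_ivl G e" "pt G e c \<notin> W" "\<bar>t - c\<bar> < l"
    using assms(2) by (auto simp: core_def)
  then have "bdist (pt G e t) \<le> \<bar>t - c\<bar>" using assms by (intro gdist_set_frontier_le)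
  then show ?thesis using c(3) assms(3) by (simp add: boundary_strip_def)
qed

lemma cutoff_eq_1:
  assumes "e \<in> edges G" "t \<in> edge_ivl G e" "pt G e t \<in> W" "l \<le> bdist (pt G e t)"
  shows "cutoff e t = 1"
proof -
  have "l \<le> \<bar>t - c\<bar>" if "c \<in> edge_ivl G e" "pt G e c \<notin> W" for c
    using gdist_set_frontier_le[OF assms(1,2) that(1) assms(3) that(2)] assms(4) by linarith
  then have "t \<in> core e" using assms(2) by (simp add: core_def)
  then show ?thesis by (rule tent_eq_1[OF l])
qed

text \<open>Here the absence of vertices in the strip enters: a vertex of \<open>W\<close> is
  farther than \<open>l\<close> from the frontier, hence in the core of every incident edge. The
  value therefore depends on the vertex alone, as the Kirchhoff condition requires.\<close>

lemma cutoff_vertex: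
  assumes "e \<in> edges G" "t \<in> edge_ivl G e" "pt G e t = Vertex v"
  shows "cutoff e t = (if Vertex v \<in> W then 1 else 0)"
proof (cases "Vertex v \<in> W")
  case True
  have "Vertex v \<in> points G" using pt_in_points[OF assms(1,2)] assms(3) by simp
  then have "v \<in> verts G" by (auto simp: points_def)
  then have "Vertex v \<notin> B" using no_vertex by blast
  then show ?thesis using True cutoff_eq_1[OF assms(1,2)] assms(3) by (auto simp: boundary_strip_def)
next
  case False
  then show ?thesis
    using cutoff_pos_imp_W[OF assms(2)] assms(3) tent_nonneg[OF l, of "core e" t] by fastforce
qed

end

section \<open>Routes without repetitions\<close>

text \<open>A route as a list of its segments, so that segments can be merged, and collected edge by
  edge.\<close>

fun chain :: "('v, 'e) mgraph \<Rightarrow> ('v, 'e) gpoint \<Rightarrow> ('e \<times> real \<times> real) list \<Rightarrow> ('v, 'e) gpoint \<Rightarrow> bool" where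
  "chain G x [] y \<longleftrightarrow> x = y"
| "chain G x ((e, s, t) # c) y \<longleftrightarrow>
    e \<in> edges G \<and> s \<in> edge_ivl G e \<and> t \<in> edge_ivl G e \<and> x = pt G e s \<and> chain G (pt G e t) c y"

abbreviation chain_length :: "('e \<times> real \<times> real) list \<Rightarrow> real" where
  "chain_length c \<equiv> \<Sum>(e, s, t)\<leftarrow>c. \<bar>s - t\<bar>"

text \<open>Disjointness is tested on the parameters of a common edge: segments of different edges
  may meet at a vertex, and the two ends of a loop count as different.\<close>

definition segments_disjoint :: "'e \<times> real \<times> real \<Rightarrow> 'e \<times> real \<times> real \<Rightarrow> bool" where
  "segments_disjoint a b \<longleftrightarrow> (case a of (e, s, t) \<Rightarrow> case b of (e', s', t') \<Rightarrow>
    e = e' \<longrightarrow> closed_segment s t \<inter> closed_segment s' t' = {})"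

lemma chain_append: "chain G x (c @ d) z \<longleftrightarrow> (\<exists>y. chain G x c y \<and> chain G y d z)"
  by (induction c arbitrary: x) auto

lemma route_imp_chain: "route G x y r \<Longrightarrow> \<exists>c. chain G x c y \<and> chain_length c = r"
proof (induction rule: route.induct)
  case (route_refl x)
  show ?case by (intro exI[of _ "[]"]) simp
next
  case (route_step x e s r t)
  then obtain c where "chain G x c (pt G e s)" "chain_length c = r" by blast
  then show ?case using route_step.hyps
    by (intro exI[of _ "c @ [(e, s, t)]"]) (auto simp: chain_append)
qed

lemma not_sorted_wrtD:
  "\<not> sorted_wrt P c \<Longrightarrow> \<exists>c1 a c2 b c3. c = c1 @ a # c2 @ b # c3 \<and> \<not> P a b"
proof (induction c)
  case (Cons a c)
  show ?case
  proof (cases "sorted_wrt P c")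
    case True
    then obtain b where "b \<in> set c" "\<not> P a b" using Cons.prems by auto
    then obtain c2 c3 where "a # c = [] @ a # c2 @ b # c3" by (auto dest: split_list)
    then show ?thesis using \<open>\<not> P a b\<close> by blast
  next
    case False
    then obtain c1 a' c2 b c3 where "c = c1 @ a' # c2 @ b # c3" "\<not> P a' b" using Cons.IH by blast
    then have "a # c = (a # c1) @ a' # c2 @ b # c3" by simp
    then show ?thesis using \<open>\<not> P a' b\<close> by blast
  qed
qed simp

lemma chain_length_nonneg: "0 \<le> chain_length c"
  by (rule sum_list_nonneg) auto

text \<open>Two overlapping segments of one edge can be merged with everything between them; this shortens
  the list, so a list with the least number of segments has none.\<close>

lemma route_imp_disjoint_chain:
  assumes "route G x y r"
  obtains c where "chain G x c y" "chain_length c \<le> r" "sorted_wrt segments_disjoint c"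
proof -
  obtain c where c: "chain G x c y \<and> chain_length c \<le> r"
    and min: "\<And>d. chain G x d y \<and> chain_length d \<le> r \<Longrightarrow> length c \<le> length d"
    using ex_has_least_nat[of "\<lambda>c. chain G x c y \<and> chain_length c \<le> r" _ length]
      route_imp_chain[OF assms] by (metis order_refl)
  have "sorted_wrt segments_disjoint c"
  proof (rule ccontr)
    assume "\<not> ?thesis"
    then obtain c1 a c2 b c3 where ab: "c = c1 @ a # c2 @ b # c3" "\<not> segments_disjoint a b"
      using not_sorted_wrtD by blast
    then obtain e s t s' t' p where e: "a = (e, s, t)" "b = (e, s', t')"
      and p: "p \<in> closed_segment s t" "p \<in> closed_segment s' t'"
      by (auto simp: segments_disjoint_def split: prod.splits)
    have "chain G x (c1 @ (e, s, t') # c3) y"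
      using c by (auto simp: ab e chain_append)
    \<comment> \<open>From \<open>s\<close> to \<open>p\<close> runs inside the first segment, from
      \<open>p\<close> to \<open>t'\<close> inside the second.\<close>
    moreover have "\<bar>s - t'\<bar> \<le> \<bar>s - t\<bar> + \<bar>s' - t'\<bar>"
      using p by (auto simp: closed_segment_eq_real_ivl split: if_splits)
    then have "chain_length (c1 @ (e, s, t') # c3) \<le> chain_length c"
      using chain_length_nonneg[of c2] by (simp add: ab e)
    ultimately have "length c \<le> length (c1 @ (e, s, t') # c3)"
      using c by (intro min) auto
    then show False by (simp add: ab)
  qed
  then show ?thesis using c that by blast
qed

text \<open>Cauchy--Schwarz along the chain, by iterating \<open>square_add_le\<close>.\<close>

lemma chain_square_le:
  fixes f :: "('v, 'e) gpoint \<Rightarrow> real" and \<phi> :: "'e \<times> real \<times> real \<Rightarrow> real"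
  assumes \<phi>: "\<And>e s t. e \<in> edges G \<Longrightarrow> s \<in> edge_ivl G e \<Longrightarrow> t \<in> edge_ivl G e \<Longrightarrow>
      0 \<le> \<phi> (e, s, t) \<and> (f (pt G e t) - f (pt G e s))\<^sup>2 \<le> \<bar>s - t\<bar> * \<phi> (e, s, t)"
  shows "chain G x c y \<Longrightarrow> 0 \<le> (\<Sum>a\<leftarrow>c. \<phi> a) \<and> (f y - f x)\<^sup>2 \<le> chain_length c * (\<Sum>a\<leftarrow>c. \<phi> a)"
proof (induction c arbitrary: x)
  case (Cons a c)
  obtain e s t where a: "a = (e, s, t)" by (cases a)
  have st: "e \<in> edges G" "s \<in> edge_ivl G e" "t \<in> edge_ivl G e" "x = pt G e s" "chain G (pt G e t) c y"
    using Cons.prems by (auto simp: a)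
  have "((f (pt G e t) - f x) + (f y - f (pt G e t)))\<^sup>2 \<le>
      (\<bar>s - t\<bar> + chain_length c) * (\<phi> (e, s, t) + (\<Sum>a\<leftarrow>c. \<phi> a))"
    using \<phi>[OF st(1-3)] Cons.IH[OF st(5)] st(4) chain_length_nonneg[of c]
    by (intro square_add_le) auto
  then show ?case using \<phi>[OF st(1-3)] Cons.IH[OF st(5)] by (simp add: a)
qed simp

lemma sum_list_partition:
  fixes \<phi> :: "'a \<Rightarrow> real"
  shows "(\<Sum>a\<leftarrow>c. \<phi> a) = (\<Sum>a\<leftarrow>filter P c. \<phi> a) + (\<Sum>a\<leftarrow>filter (\<lambda>a. \<not> P a) c. \<phi> a)"
  by (induction c) auto

lemma sum_list_group:
  fixes \<phi> :: "'a \<Rightarrow> real"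
  assumes "finite A" "g ` set c \<subseteq> A"
  shows "(\<Sum>a\<leftarrow>c. \<phi> a) = (\<Sum>x\<in>A. \<Sum>a\<leftarrow>filter (\<lambda>a. g a = x) c. \<phi> a)"
  using assms(2)
proof (induction c)
  case (Cons a c)
  have "(\<Sum>x\<in>A. \<Sum>a\<leftarrow>filter (\<lambda>a. g a = x) (a # c). \<phi> a) =
    (\<Sum>x\<in>A. (if g a = x then \<phi> a else 0) + (\<Sum>a\<leftarrow>filter (\<lambda>a. g a = x) c. \<phi> a))"
    by (intro sum.cong) auto
  also have "\<dots> = \<phi> a + (\<Sum>a\<leftarrow>c. \<phi> a)"
    using Cons assms(1) by (simp add: sum.distrib sum.delta)
  finally show ?case by simp
qed simp

text \<open>The first segment splits the interval; each other one lies entirely on one side of it.\<close>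

lemma sum_disjoint_segments_le:
  fixes \<Phi> :: "real \<Rightarrow> real \<Rightarrow> real"
  assumes nonneg: "\<And>x y. a0 \<le> x \<Longrightarrow> x \<le> y \<Longrightarrow> y \<le> b0 \<Longrightarrow> 0 \<le> \<Phi> x y"
    and add: "\<And>x y z. a0 \<le> x \<Longrightarrow> x \<le> y \<Longrightarrow> y \<le> z \<Longrightarrow> z \<le> b0 \<Longrightarrow> \<Phi> x z = \<Phi> x y + \<Phi> y z"
  shows "a0 \<le> a \<Longrightarrow> a \<le> b \<Longrightarrow> b \<le> b0 \<Longrightarrow>
    sorted_wrt (\<lambda>(s, t) (s', t'). closed_segment s t \<inter> closed_segment s' t' = {}) c \<Longrightarrow>
    (\<And>s t. (s, t) \<in> set c \<Longrightarrow> closed_segment s t \<subseteq> {a..b}) \<Longrightarrow>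
    (\<Sum>(s, t)\<leftarrow>c. \<Phi> (min s t) (max s t)) \<le> \<Phi> a b"
proof (induction "length c" arbitrary: c a b rule: less_induct)
  case less
  let ?d = "\<lambda>(s, t) (s', t'). closed_segment s t \<inter> closed_segment s' t' = ({} :: real set)"
  show ?case
  proof (cases c)
    case Nil
    then show ?thesis using nonneg less.prems by simp
  next
    case (Cons z c')
    obtain s t where z: "z = (s, t)" by (cases z)
    define u where "u = min s t"
    define v where "v = max s t"
    define L where "L z = (max (fst z) (snd z) \<le> u)" for z :: "real \<times> real"
    have uv: "closed_segment s t = {u..v}" "u \<le> v" by (auto simp: closed_segment_eq_real_ivl u_def v_def)
    have "{u..v} \<subseteq> {a..b}" using less.prems(5)[of s t] uv by (simp add: Cons z)
    then have ab: "a \<le> u" "v \<le> b" using uv(2) by auto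
    have seg: "closed_segment x y = {min x y..max x y}" for x y :: real
      by (auto simp: closed_segment_eq_real_ivl)
    have side: "closed_segment x y \<subseteq> {a..b}" "max x y \<le> u \<or> v \<le> min x y" if "(x, y) \<in> set c'" for x y
    proof -
      show sub: "closed_segment x y \<subseteq> {a..b}" using less.prems(5) that by (auto simp: Cons)
      have "{u..v} \<inter> {min x y..max x y} = {}"
        using less.prems(4) that uv seg by (auto simp: Cons z)
      then show "max x y \<le> u \<or> v \<le> min x y" using uv(2) by (auto simp: min_def max_def split: if_splits)
    qed
    have "(\<Sum>(s, t)\<leftarrow>filter L c'. \<Phi> (min s t) (max s t)) \<le> \<Phi> a u"
    proof (rule less.hyps)
      show "length (filter L c') < length c" by (simp add: Cons le_imp_less_Suc)
      show "sorted_wrt ?d (filter L c')"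
        using less.prems(4) by (intro sorted_wrt_filter) (simp add: Cons)
      show "closed_segment x y \<subseteq> {a..u}" if "(x, y) \<in> set (filter L c')" for x y
        using side[of x y] that by (auto simp: seg L_def)
    qed (use less.prems ab uv in auto)
    moreover have "(\<Sum>(s, t)\<leftarrow>filter (\<lambda>z. \<not> L z) c'. \<Phi> (min s t) (max s t)) \<le> \<Phi> v b"
    proof (rule less.hyps)
      show "length (filter (\<lambda>z. \<not> L z) c') < length c" by (simp add: Cons le_imp_less_Suc)
      show "sorted_wrt ?d (filter (\<lambda>z. \<not> L z) c')"
        using less.prems(4) by (intro sorted_wrt_filter) (simp add: Cons)
      show "closed_segment x y \<subseteq> {v..b}" if "(x, y) \<in> set (filter (\<lambda>z. \<not> L z) c')" for x y
        using side[of x y] that by (auto simp: seg L_def)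
    qed (use less.prems ab uv in auto)
    moreover have "\<Phi> a b = \<Phi> a u + (\<Phi> u v + \<Phi> v b)"
      using add[of a u b] add[of u v b] less.prems ab uv by simp
    ultimately show ?thesis
      using sum_list_partition[of "\<lambda>(s, t). \<Phi> (min s t) (max s t)" c' L]
      by (simp add: Cons z u_def v_def)
  qed
qed

section \<open>Energy of the localized eigenfunction\<close>

text \<open>\<open>g\<close> and \<open>D\<close> are the witnesses of the existential quantifiers
  in \<open>H1_on\<close> and \<open>eigenfunction\<close>. Both represent \<psi>': \<open>g\<close>
  lives on the graph and brings square integrability, \<open>D\<close> lives on the edges and has
  values at both ends of each.\<close>

locale region_eigenfunction = graph_region G Lmin W l
  for G :: "('v, 'e) mgraph" and Lmin :: real and W :: "('v, 'e) gpoint set" and l :: real +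
  fixes V \<psi> g :: "('v, 'e) gpoint \<Rightarrow> real" and E :: real and D :: "'e \<Rightarrow> real \<Rightarrow> real" and dmax :: nat
  assumes degree: "degree_bounded G dmax"
    and V_nonneg: "\<And>x. x \<in> points G \<Longrightarrow> 0 \<le> V x"
    and integrable_\<psi>: "integrable (arc_length G) (\<lambda>x. (\<psi> x)\<^sup>2)"
    and integrable_V: "integrable (arc_length G) (\<lambda>x. V x * (\<psi> x)\<^sup>2)"
    and integrable_g: "integrable (arc_length G) (\<lambda>x. (g x)\<^sup>2)"
    and ac_\<psi>: "\<And>e. e \<in> edges G \<Longrightarrow> loc_abs_cont_on (edge_ivl G e) (\<lambda>t. \<psi> (pt G e t))"
    and weak_der: "\<And>e. e \<in> edges G \<Longrightarrow> AE t in lebesgue. t \<in> edge_ivl G e \<longrightarrow>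
      ((\<lambda>t. \<psi> (pt G e t)) has_real_derivative g (pt G e t)) (at t within edge_ivl G e)"
    and der: "\<And>e t. e \<in> edges G \<Longrightarrow> t \<in> edge_ivl G e \<Longrightarrow>
      ((\<lambda>t. \<psi> (pt G e t)) has_real_derivative D e t) (at t within edge_ivl G e)"
    and ac_D: "\<And>e. e \<in> edges G \<Longrightarrow> loc_abs_cont_on (edge_ivl G e) (D e)"
    and ode: "\<And>e. e \<in> edges G \<Longrightarrow> AE t in lebesgue. t \<in> edge_ivl G e \<longrightarrow>
      (\<exists>\<psi>2. (D e has_real_derivative \<psi>2) (at t within edge_ivl G e) \<and>
        - \<psi>2 + V (pt G e t) * \<psi> (pt G e t) = E * \<psi> (pt G e t))"
    and kirchhoff: "\<And>v. v \<in> verts G \<Longrightarrow> (\<Sum>e\<in>lo_edges G v. D e (real_of_ereal (lo G e))) +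
      (\<Sum>e\<in>hi_edges G v. - D e (real_of_ereal (hi G e))) = 0"
begin

text \<open>A majorant of (\<eta>')^2 \<psi>^2 + \<eta>^2 (E - V) \<psi>^2: the slope is at most
  \<open>1 / l\<close> in size and confined to \<open>B\<close>, and \<eta> is at most 1 and
  vanishes outside \<open>W\<close>. Its integral is the constant of the theorem.\<close>

definition \<kappa> :: "('v, 'e) gpoint \<Rightarrow> real" where
  "\<kappa> x = 1 / l\<^sup>2 * (indicator B x * (\<psi> x)\<^sup>2) + indicator W x * (max (E - V x) 0 * (\<psi> x)\<^sup>2)"

definition total_energy :: real where
  "total_energy = 1 / l\<^sup>2 * (LINT y:B|arc_length G. (\<psi> y)\<^sup>2)
    + (LINT y:W|arc_length G. max (E - V y) 0 * (\<psi> y)\<^sup>2)"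

lemma \<kappa>_nonneg: "0 \<le> \<kappa> x"
  by (simp add: \<kappa>_def)

lemma integrable_well: "integrable (arc_length G) (\<lambda>x. max (E - V x) 0 * (\<psi> x)\<^sup>2)"
proof (rule Bochner_Integration.integrable_bound)
  show "integrable (arc_length G) (\<lambda>x. \<bar>E\<bar> * (\<psi> x)\<^sup>2)" using integrable_\<psi> by simp
  \<comment> \<open>Measurability is read off the two integrable products, so \<open>V\<close>
    enters only multiplied by \<psi>^2.\<close>
  have "(\<lambda>x. max (E * (\<psi> x)\<^sup>2 - V x * (\<psi> x)\<^sup>2) 0) \<in> borel_measurable (arc_length G)"
    using integrable_\<psi> integrable_V by (intro borel_measurable_max borel_measurable_diff) auto
  moreover have "max (E * (\<psi> x)\<^sup>2 - V x * (\<psi> x)\<^sup>2) 0 = max (E - V x) 0 * (\<psi> x)\<^sup>2" for x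
    by (simp add: max_mult_distrib_right left_diff_distrib)
  ultimately show "(\<lambda>x. max (E - V x) 0 * (\<psi> x)\<^sup>2) \<in> borel_measurable (arc_length G)" by simp
  show "AE x in arc_length G. norm (max (E - V x) 0 * (\<psi> x)\<^sup>2) \<le> norm (\<bar>E\<bar> * (\<psi> x)\<^sup>2)"
  proof (rule AE_I2)
    fix x assume "x \<in> space (arc_length G)"
    then have "0 \<le> V x" using V_nonneg by (simp add: space_arc_length)
    then have "max (E - V x) 0 \<le> \<bar>E\<bar>" by auto
    then show "norm (max (E - V x) 0 * (\<psi> x)\<^sup>2) \<le> norm (\<bar>E\<bar> * (\<psi> x)\<^sup>2)"
      by (simp add: abs_mult mult_right_mono)
  qed
qed

lemma integrable_\<kappa>: "integrable (arc_length G) \<kappa>"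
  and integral_\<kappa>: "integral\<^sup>L (arc_length G) \<kappa> = total_energy"
proof -
  have 1: "integrable (arc_length G) (\<lambda>x. indicator B x * (\<psi> x)\<^sup>2)"
    using integrable_mult_indicator[OF B_sets integrable_\<psi>] by simp
  have 2: "integrable (arc_length G) (\<lambda>x. indicator W x * (max (E - V x) 0 * (\<psi> x)\<^sup>2))"
    using integrable_mult_indicator[OF W_sets integrable_well] by simp
  show "integrable (arc_length G) \<kappa>"
    unfolding \<kappa>_def by (intro Bochner_Integration.integrable_add integrable_mult_right 1 2)
  show "integral\<^sup>L (arc_length G) \<kappa> = total_energy"
    unfolding \<kappa>_def total_energy_def set_lebesgue_integral_def
    using 1 2 by simp
qed

lemma \<kappa>_absolutely_integrable: "e \<in> edges G \<Longrightarrow> (\<lambda>t. \<kappa> (pt G e t)) absolutely_integrable_on edge_ivl G e"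
  by (rule absolutely_integrable_edge[OF integrable_\<kappa> \<kappa>_nonneg])

lemma \<kappa>_integrable_on:
  assumes "e \<in> edges G" "S \<subseteq> edge_ivl G e" "closed S"
  shows "(\<lambda>t. \<kappa> (pt G e t)) integrable_on S"
proof -
  have "(\<lambda>t. \<kappa> (pt G e t)) absolutely_integrable_on S"
    by (rule set_integrable_subset[OF \<kappa>_absolutely_integrable[OF assms(1)] _ assms(2)]) (simp add: assms(3))
  then show ?thesis by (simp add: absolutely_integrable_on_def)
qed

definition flux :: "'e \<Rightarrow> real \<Rightarrow> real" where
  "flux e t = (cutoff e t)\<^sup>2 * \<psi> (pt G e t) * D e t"

text \<open>Integration by parts turns this into an upper bound for the integral of the squared derivative
  of the localized eigenfunction over the segment from \<open>a\<close> to \<open>b\<close>.\<close>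

definition energy :: "'e \<Rightarrow> real \<Rightarrow> real \<Rightarrow> real" where
  "energy e a b = flux e b - flux e a + integral {a..b} (\<lambda>t. \<kappa> (pt G e t))"

lemma ode_null_set:
  assumes e: "e \<in> edges G"
  obtains N where "N \<in> null_sets lebesgue"
    "\<And>t. t \<in> edge_ivl G e - N \<Longrightarrow>
      (D e has_real_derivative (V (pt G e t) - E) * \<psi> (pt G e t)) (at t within edge_ivl G e)"
proof -
  obtain N where N: "N \<in> null_sets lebesgue" "{t \<in> space lebesgue. \<not> (t \<in> edge_ivl G e \<longrightarrow>
      (\<exists>\<psi>2. (D e has_real_derivative \<psi>2) (at t within edge_ivl G e) \<and>
        - \<psi>2 + V (pt G e t) * \<psi> (pt G e t) = E * \<psi> (pt G e t)))} \<subseteq> N"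
    using ode[OF e] unfolding eventually_ae_filter by blast
  have "(D e has_real_derivative (V (pt G e t) - E) * \<psi> (pt G e t)) (at t within edge_ivl G e)"
    if "t \<in> edge_ivl G e - N" for t
  proof -
    obtain \<psi>2 where "(D e has_real_derivative \<psi>2) (at t within edge_ivl G e)"
        "- \<psi>2 + V (pt G e t) * \<psi> (pt G e t) = E * \<psi> (pt G e t)"
      using N(2) \<open>t \<in> edge_ivl G e - N\<close> by auto
    moreover from this(2) have "\<psi>2 = (V (pt G e t) - E) * \<psi> (pt G e t)" by (simp add: algebra_simps)
    ultimately show ?thesis by simp
  qed
  then show thesis using N(1) that by blast
qed

lemma energy_cutoff:
  assumes e: "e \<in> edges G" and ab: "a \<in> edge_ivl G e" "b \<in> edge_ivl G e" "a \<le> b"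
  shows energy_nonneg: "0 \<le> energy e a b"
    and energy_ge: "(cutoff e b * \<psi> (pt G e b) - cutoff e a * \<psi> (pt G e a))\<^sup>2 \<le> (b - a) * energy e a b"
proof -
  obtain N where N: "N \<in> null_sets lebesgue"
    "\<And>t. t \<in> edge_ivl G e - N \<Longrightarrow>
      (D e has_real_derivative (V (pt G e t) - E) * \<psi> (pt G e t)) (at t within edge_ivl G e)"
    using ode_null_set[OF e] by blast
  have sub: "{a..b} \<subseteq> edge_ivl G e" using Icc_subset_edge_ivl ab by blast
  have W: "pt G e t \<in> W" if "t \<in> {a..b}" "0 < cutoff e t" for t
    using cutoff_pos_imp_W that sub by blast
  have 1: "((\<lambda>t. \<psi> (pt G e t)) has_real_derivative D e t) (at t within {a..b})" if "t \<in> {a..b}" for t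
    using sub that by (intro DERIV_subset[OF der[OF e] sub]) blast
  have 2: "abs_cont_on {a..b} (\<lambda>t. \<psi> (pt G e t))" "abs_cont_on {a..b} (D e)"
    using ac_\<psi>[OF e] ac_D[OF e] sub by (auto simp: loc_abs_cont_on_def)
  have 3: "(D e has_real_derivative (V (pt G e t) - E) * \<psi> (pt G e t)) (at t within {a..b})"
    if "t \<in> {a..b} - N" for t
    using sub that by (intro DERIV_subset[OF N(2) sub]) blast
  have 4: "(\<lambda>t. \<kappa> (pt G e t)) integrable_on {a..b}"
    using \<kappa>_integrable_on[OF e sub] by simp
  have 5: "max (E - V (pt G e t)) 0 * (\<psi> (pt G e t))\<^sup>2 \<le> \<kappa> (pt G e t)"
    if "t \<in> {a..b}" "0 < cutoff e t" for t
    using W[OF that] by (simp add: \<kappa>_def)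
  have 6: "(\<psi> (pt G e t))\<^sup>2 / l\<^sup>2 + max (E - V (pt G e t)) 0 * (\<psi> (pt G e t))\<^sup>2 \<le> \<kappa> (pt G e t)"
    if t: "t \<in> {a..b}" "0 < cutoff e t" "cutoff e t < 1" for t
  proof -
    have "pt G e t \<in> B" using cutoff_less_1_imp_B[OF e _ W[OF t(1,2)] t(3)] t(1) sub by blast
    then show ?thesis using W[OF t(1,2)] by (simp add: \<kappa>_def)
  qed
  note tent_cutoff_energy[OF ab(3) l closed_core core_gap 1 2 N(1) 3 4 \<kappa>_nonneg 5 6]
  then show "0 \<le> energy e a b"
    and "(cutoff e b * \<psi> (pt G e b) - cutoff e a * \<psi> (pt G e a))\<^sup>2 \<le> (b - a) * energy e a b"
    by (simp_all add: energy_def flux_def)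
qed

lemma energy_add:
  assumes "e \<in> edges G" "a \<in> edge_ivl G e" "c \<in> edge_ivl G e" "a \<le> b" "b \<le> c"
  shows "energy e a c = energy e a b + energy e b c"
proof -
  have "(\<lambda>t. \<kappa> (pt G e t)) integrable_on {a..c}"
    using assms by (intro \<kappa>_integrable_on Icc_subset_edge_ivl) auto
  then show ?thesis
    using Henstock_Kurzweil_Integration.integral_combine[OF assms(4,5), of "\<lambda>t. \<kappa> (pt G e t)"]
    by (simp add: energy_def)
qed

section \<open>Uniform bounds for the boundary terms\<close>

definition density :: "('v, 'e) gpoint \<Rightarrow> real" where
  "density x = (\<psi> x)\<^sup>2 + (g x)\<^sup>2 + (V x * (\<psi> x)\<^sup>2 + \<bar>E\<bar> * (\<psi> x)\<^sup>2)"

lemma density_nonneg: "x \<in> points G \<Longrightarrow> 0 \<le> density x"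
  using V_nonneg by (simp add: density_def)

lemma integrable_density: "integrable (arc_length G) density"
  unfolding density_def
  by (intro Bochner_Integration.integrable_add integrable_mult_right integrable_\<psi> integrable_g integrable_V)

text \<open>This dominates both |\<psi> D| and its derivative D^2 + (V - E) \<psi>^2 at every point
  where they occur. It differs from \<open>density\<close> only by \<open>D\<close> in place of
  \<open>g\<close>, hence on a null set of the edge, and \<open>density\<close> is integrable over
  the whole graph.\<close>

definition edge_density :: "'e \<Rightarrow> real \<Rightarrow> real" where
  "edge_density e t = (\<psi> (pt G e t))\<^sup>2 + (D e t)\<^sup>2
    + (V (pt G e t) * (\<psi> (pt G e t))\<^sup>2 + \<bar>E\<bar> * (\<psi> (pt G e t))\<^sup>2)"

lemma edge_density_nonneg: "e \<in> edges G \<Longrightarrow> t \<in> edge_ivl G e \<Longrightarrow> 0 \<le> edge_density e t"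
  using V_nonneg[OF pt_in_points] by (simp add: edge_density_def)

lemma edge_density_has_integral:
  assumes e: "e \<in> edges G"
  shows "(edge_density e has_integral integral (edge_ivl G e) (\<lambda>t. density (pt G e t))) (edge_ivl G e)"
proof -
  obtain N where N: "N \<in> null_sets lebesgue" "{t \<in> space lebesgue. \<not> (t \<in> edge_ivl G e \<longrightarrow>
      ((\<lambda>t. \<psi> (pt G e t)) has_real_derivative g (pt G e t)) (at t within edge_ivl G e))} \<subseteq> N"
    using weak_der[OF e] unfolding eventually_ae_filter by blast
  have "negligible N" using N(1) negligible_iff_null_sets by blast
  moreover have "edge_density e t = density (pt G e t)" if t: "t \<in> edge_ivl G e - N" for t
  proof -
    have "((\<lambda>t. \<psi> (pt G e t)) has_real_derivative g (pt G e t)) (at t within edge_ivl G e)"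
      using N(2) t by auto
    moreover have "((\<lambda>t. \<psi> (pt G e t)) has_real_derivative D e t) (at t within edge_ivl G e)"
      using der[OF e] t by auto
    moreover have "at t within edge_ivl G e \<noteq> bot"
      using at_within_edge_ivl_neq_bot[OF e] t by auto
    ultimately have "D e t = g (pt G e t)"
      by (meson vector_derivative_unique_within has_real_derivative_iff_has_vector_derivative)
    then show ?thesis by (simp add: edge_density_def density_def)
  qed
  moreover have "((\<lambda>t. density (pt G e t)) has_integral
      integral (edge_ivl G e) (\<lambda>t. density (pt G e t))) (edge_ivl G e)"
    using absolutely_integrable_edge[OF integrable_density density_nonneg e]
    by (auto simp: absolutely_integrable_on_def intro: integrable_integral)
  ultimately show ?thesis by (rule has_integral_spike)
qed

lemma abs_mult_le_sum_squares: "\<bar>x * y\<bar> \<le> x\<^sup>2 + (y::real)\<^sup>2"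
proof -
  have "2 * \<bar>x * y\<bar> \<le> x\<^sup>2 + y\<^sup>2" using sum_squares_bound[of "\<bar>x\<bar>" "\<bar>y\<bar>"] by (simp add: abs_mult)
  then show ?thesis by linarith
qed

lemma abs_\<psi>D_le: "e \<in> edges G \<Longrightarrow> t \<in> edge_ivl G e \<Longrightarrow> \<bar>\<psi> (pt G e t) * D e t\<bar> \<le> edge_density e t"
  using abs_mult_le_sum_squares[of "\<psi> (pt G e t)" "D e t"] V_nonneg[OF pt_in_points, of e t]
  by (simp add: edge_density_def add_increasing2)

lemma abs_flux_le: "\<bar>flux e t\<bar> \<le> \<bar>\<psi> (pt G e t) * D e t\<bar>"
proof -
  have "(cutoff e t)\<^sup>2 * \<bar>\<psi> (pt G e t) * D e t\<bar> \<le> 1 * \<bar>\<psi> (pt G e t) * D e t\<bar>"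
    using tent_nonneg[OF l, of "core e" t] tent_le_1[OF l, of "core e" t]
    by (intro mult_right_mono) (auto simp: power_le_one)
  then show ?thesis by (simp add: flux_def abs_mult mult.assoc)
qed

lemma integral_edge_density_ge:
  assumes e: "e \<in> edges G" and ab: "{a..b} \<subseteq> edge_ivl G e" "a \<le> b"
    and c: "\<And>t. t \<in> {a..b} \<Longrightarrow> c \<le> edge_density e t"
  shows "(b - a) * c \<le> integral (edge_ivl G e) (\<lambda>t. density (pt G e t))"
proof -
  note I = edge_density_has_integral[OF e]
  have i: "edge_density e integrable_on {a..b}"
    by (rule integrable_on_subinterval[OF has_integral_integrable[OF I] ab(1)])
  have "(b - a) * c = integral {a..b} (\<lambda>t. c)" using ab by simp
  also have "\<dots> \<le> integral {a..b} (edge_density e)"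
    using c by (intro integral_le i integrable_const_ivl) auto
  also have "\<dots> \<le> integral (edge_ivl G e) (edge_density e)"
    using edge_density_nonneg[OF e] by (intro integral_subset_le ab(1) i has_integral_integrable[OF I]) auto
  finally show ?thesis using integral_unique[OF I] by simp
qed

text \<open>A window of length exactly \<open>Lmin\<close> gives every edge the same constant; this
  is how the lower bound on edge lengths yields summability.\<close>

lemma abs_flux_le_integral:
  assumes e: "e \<in> edges G" and ab: "{a..b} \<subseteq> edge_ivl G e" "b - a = Lmin" and t: "t \<in> {a..b}"
  shows "\<bar>flux e t\<bar> \<le> (1 / Lmin + 1) * integral (edge_ivl G e) (\<lambda>t. density (pt G e t))"
proof -
  note I = edge_density_has_integral[OF e]
  obtain N where N: "N \<in> null_sets lebesgue"
    "\<And>t. t \<in> edge_ivl G e - N \<Longrightarrow>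
      (D e has_real_derivative (V (pt G e t) - E) * \<psi> (pt G e t)) (at t within edge_ivl G e)"
    using ode_null_set[OF e] by blast
  \<comment> \<open>The derivative of \<psi> \<psi>' by the product rule and the differential
    equation.\<close>
  define q where "q t = (D e t)\<^sup>2 + (V (pt G e t) - E) * (\<psi> (pt G e t))\<^sup>2" for t
  have i: "edge_density e integrable_on {a..b}"
    by (rule integrable_on_subinterval[OF has_integral_integrable[OF I] ab(1)])
  have "\<bar>\<psi> (pt G e t) * D e t\<bar> \<le> (1 / (b - a) + 1) * integral {a..b} (edge_density e)"
  proof (rule abs_le_integral_of_bound[OF _ _ N(1) _ i _ _ t])
    show "a < b" using ab(2) Lmin(1) by simp
    show "abs_cont_on {a..b} (\<lambda>t. \<psi> (pt G e t) * D e t)"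
      using ac_\<psi>[OF e] ac_D[OF e] ab(1) by (intro abs_cont_on_mult) (auto simp: loc_abs_cont_on_def)
    show "((\<lambda>t. \<psi> (pt G e t) * D e t) has_real_derivative q t) (at t within {a..b})" if "t \<in> {a..b} - N" for t
    proof (rule DERIV_subset[OF _ ab(1)])
      show "((\<lambda>t. \<psi> (pt G e t) * D e t) has_real_derivative q t) (at t within edge_ivl G e)"
        using that ab(1)
        by (auto intro!: derivative_eq_intros der[OF e] N(2) simp: q_def power2_eq_square algebra_simps)
    qed
    show "\<bar>\<psi> (pt G e t) * D e t\<bar> \<le> edge_density e t" if "t \<in> {a..b}" for t
      using abs_\<psi>D_le[OF e] that ab(1) by blast
    show "\<bar>q t\<bar> \<le> edge_density e t" if "t \<in> {a..b}" for t
    proof -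
      have "0 \<le> V (pt G e t)" using V_nonneg[OF pt_in_points[OF e]] that ab(1) by blast
      then have "\<bar>V (pt G e t) - E\<bar> * (\<psi> (pt G e t))\<^sup>2 \<le> (V (pt G e t) + \<bar>E\<bar>) * (\<psi> (pt G e t))\<^sup>2"
        by (intro mult_right_mono) auto
      moreover have "\<bar>q t\<bar> \<le> \<bar>(D e t)\<^sup>2\<bar> + \<bar>(V (pt G e t) - E) * (\<psi> (pt G e t))\<^sup>2\<bar>"
        unfolding q_def by (rule abs_triangle_ineq)
      ultimately show ?thesis by (simp add: edge_density_def abs_mult distrib_right) (smt (verit) zero_le_power2)
    qed
  qed
  also have "\<dots> \<le> (1 / (b - a) + 1) * integral (edge_ivl G e) (edge_density e)"
    using edge_density_nonneg[OF e] ab Lmin(1)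
    by (intro mult_left_mono integral_subset_le i has_integral_integrable[OF I]) auto
  finally show ?thesis using abs_flux_le[of e t] integral_unique[OF I] ab(2) by simp
qed

text \<open>The value 0 at an infinite end stands for a boundary term at infinity;
  \<open>flux_le_hi\<close> justifies it.\<close>

definition hi_flux :: "'e \<Rightarrow> real" where
  "hi_flux e = (if hi G e = \<infinity> then 0 else flux e (real_of_ereal (hi G e)))"

definition lo_flux :: "'e \<Rightarrow> real" where
  "lo_flux e = (if lo G e = -\<infinity> then 0 else flux e (real_of_ereal (lo G e)))"

lemma integral_density_nonneg: "e \<in> edges G \<Longrightarrow> 0 \<le> integral (edge_ivl G e) (\<lambda>t. density (pt G e t))"
  using edge_density_has_integral edge_density_nonneg by (meson has_integral_nonneg)

lemma edge_length: "e \<in> edges G \<Longrightarrow> ereal Lmin \<le> hi G e - lo G e"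
  using Lmin(2) by (simp add: edge_length_ge_def)

lemma abs_hi_flux_le:
  assumes e: "e \<in> edges G"
  shows "\<bar>hi_flux e\<bar> \<le> (1 / Lmin + 1) * integral (edge_ivl G e) (\<lambda>t. density (pt G e t))"
proof (cases "hi G e = \<infinity>")
  case True
  then show ?thesis using integral_density_nonneg[OF e] Lmin(1) by (simp add: hi_flux_def)
next
  case False
  define h where "h = real_of_ereal (hi G e)"
  have h: "h \<in> edge_ivl G e" "hi G e = ereal h"
    using hi_in_edge_ivl[OF e False] hi_real[OF e False] by (simp_all add: h_def)
  have "lo G e \<le> ereal (h - Lmin)"
    using edge_length[OF e] h(2) by (cases "lo G e") auto
  then have "h - Lmin \<in> edge_ivl G e" using h Lmin(1) by (simp add: edge_ivl_def)
  then show ?thesis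
    using abs_flux_le_integral[OF e Icc_subset_edge_ivl[OF _ h(1)], of "h - Lmin" h] Lmin(1) False
    by (simp add: hi_flux_def h_def)
qed

lemma abs_lo_flux_le:
  assumes e: "e \<in> edges G"
  shows "\<bar>lo_flux e\<bar> \<le> (1 / Lmin + 1) * integral (edge_ivl G e) (\<lambda>t. density (pt G e t))"
proof (cases "lo G e = -\<infinity>")
  case True
  then show ?thesis using integral_density_nonneg[OF e] Lmin(1) by (simp add: lo_flux_def)
next
  case False
  define h where "h = real_of_ereal (lo G e)"
  have h: "h \<in> edge_ivl G e" "lo G e = ereal h"
    using lo_in_edge_ivl[OF e False] lo_real[OF e False] by (simp_all add: h_def)
  have "ereal (h + Lmin) \<le> hi G e"
    using edge_length[OF e] h(2) by (cases "hi G e") auto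
  then have "h + Lmin \<in> edge_ivl G e" using h Lmin(1) by (simp add: edge_ivl_def)
  then show ?thesis
    using abs_flux_le_integral[OF e Icc_subset_edge_ivl[OF h(1)], of "h + Lmin" h] Lmin(1) False
    by (simp add: lo_flux_def h_def)
qed

lemma integral_\<kappa>_mono:
  assumes "e \<in> edges G" "S \<subseteq> T" "T \<subseteq> edge_ivl G e" "closed S" "closed T"
  shows "integral S (\<lambda>t. \<kappa> (pt G e t)) \<le> integral T (\<lambda>t. \<kappa> (pt G e t))"
  using assms \<kappa>_nonneg by (intro integral_subset_le \<kappa>_integrable_on) auto

text \<open>On an infinite end the flux cannot stay away from \<open>0\<close>, since it is integrable.\<close>

lemma flux_le_hi:
  assumes e: "e \<in> edges G" and b: "b \<in> edge_ivl G e"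
  shows "flux e b \<le> hi_flux e + integral (edge_ivl G e \<inter> {b..}) (\<lambda>t. \<kappa> (pt G e t))"
proof (cases "hi G e = \<infinity>")
  case True
  define K where "K = integral (edge_ivl G e \<inter> {b..}) (\<lambda>t. \<kappa> (pt G e t))"
  define c where "c = flux e b - K"
  have sub: "{b..} \<subseteq> edge_ivl G e" by (rule atLeast_subset_edge_ivl[OF True b])
  have c_le: "c \<le> edge_density e t" if t: "b \<le> t" for t
  proof -
    have te: "t \<in> edge_ivl G e" using t sub by auto
    have "integral {b..t} (\<lambda>t. \<kappa> (pt G e t)) \<le> K"
      unfolding K_def using sub by (intro integral_\<kappa>_mono[OF e]) (auto intro!: closed_Int closed_edge_ivl)
    then have "c \<le> flux e t" using energy_nonneg[OF e b te t] by (simp add: c_def energy_def)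
    also have "\<dots> \<le> edge_density e t" using abs_flux_le[of e t] abs_\<psi>D_le[OF e te] by linarith
    finally show ?thesis .
  qed
  have "c \<le> 0"
  proof (rule ccontr)
    assume "\<not> c \<le> 0"
    define I where "I = integral (edge_ivl G e) (\<lambda>t. density (pt G e t))"
    have "0 \<le> I" unfolding I_def by (rule integral_density_nonneg[OF e])
    \<comment> \<open>Nonnegative energy keeps the flux at least \<open>c\<close> on the whole half
      line. If \<open>c\<close> were positive, an interval of length \<open>(I + 1) / c\<close>
      would carry more than the total \<open>I\<close>.\<close>
    then have "((b + (I + 1) / c) - b) * c \<le> I"
      unfolding I_def using sub c_le \<open>\<not> c \<le> 0\<close> by (intro integral_edge_density_ge[OF e]) auto
    then show False using \<open>\<not> c \<le> 0\<close> by simp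
  qed
  then show ?thesis using True by (simp add: c_def K_def hi_flux_def)
next
  case False
  define h where "h = real_of_ereal (hi G e)"
  have h: "h \<in> edge_ivl G e" "b \<le> h" "edge_ivl G e \<inter> {b..} = {b..h}"
    using hi_in_edge_ivl[OF e False] le_hi[OF e False] b Icc_subset_edge_ivl[OF b, of h]
    by (auto simp: h_def)
  then show ?thesis using energy_nonneg[OF e b h(1,2)] False by (simp add: energy_def hi_flux_def h_def)
qed

text \<open>The mirror image at the lower end, where the flux enters with the opposite sign.\<close>

lemma lo_le_flux:
  assumes e: "e \<in> edges G" and b: "b \<in> edge_ivl G e"
  shows "lo_flux e \<le> flux e b + integral (edge_ivl G e \<inter> {..b}) (\<lambda>t. \<kappa> (pt G e t))"
proof (cases "lo G e = -\<infinity>")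
  case True
  define K where "K = integral (edge_ivl G e \<inter> {..b}) (\<lambda>t. \<kappa> (pt G e t))"
  define c where "c = - flux e b - K"
  have sub: "{..b} \<subseteq> edge_ivl G e" by (rule atMost_subset_edge_ivl[OF True b])
  have c_le: "c \<le> edge_density e t" if t: "t \<le> b" for t
  proof -
    have te: "t \<in> edge_ivl G e" using t sub by auto
    have "integral {t..b} (\<lambda>t. \<kappa> (pt G e t)) \<le> K"
      unfolding K_def using sub by (intro integral_\<kappa>_mono[OF e]) (auto intro!: closed_Int closed_edge_ivl)
    then have "c \<le> - flux e t" using energy_nonneg[OF e te b t] by (simp add: c_def energy_def)
    also have "\<dots> \<le> edge_density e t" using abs_flux_le[of e t] abs_\<psi>D_le[OF e te] by linarith
    finally show ?thesis .
  qed
  have "c \<le> 0"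
  proof (rule ccontr)
    assume "\<not> c \<le> 0"
    define I where "I = integral (edge_ivl G e) (\<lambda>t. density (pt G e t))"
    have "0 \<le> I" unfolding I_def by (rule integral_density_nonneg[OF e])
    then have "(b - (b - (I + 1) / c)) * c \<le> I"
      unfolding I_def using sub c_le \<open>\<not> c \<le> 0\<close> by (intro integral_edge_density_ge[OF e]) auto
    then show False using \<open>\<not> c \<le> 0\<close> by simp
  qed
  then show ?thesis using True by (simp add: c_def K_def lo_flux_def)
next
  case False
  define h where "h = real_of_ereal (lo G e)"
  have h: "h \<in> edge_ivl G e" "h \<le> b" "edge_ivl G e \<inter> {..b} = {h..b}"
    using lo_in_edge_ivl[OF e False] lo_le[OF e False] b Icc_subset_edge_ivl[OF _ b, of h]
    by (auto simp: h_def)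
  then show ?thesis using energy_nonneg[OF e h(1) b h(2)] False by (simp add: energy_def lo_flux_def h_def)
qed

definition edge_total :: "'e \<Rightarrow> real" where
  "edge_total e = hi_flux e - lo_flux e + integral (edge_ivl G e) (\<lambda>t. \<kappa> (pt G e t))"

text \<open>The two parts of the edge outside \<open>{a..b}\<close> have nonnegative energy even if
  they are unbounded; this is the content of \<open>lo_le_flux\<close> and
  \<open>flux_le_hi\<close>.\<close>

lemma energy_le_edge_total:
  assumes e: "e \<in> edges G" and ab: "a \<in> edge_ivl G e" "b \<in> edge_ivl G e" "a \<le> b"
  shows "energy e a b \<le> edge_total e"
proof -
  let ?k = "\<lambda>t. \<kappa> (pt G e t)"
  let ?I = "edge_ivl G e"
  have sub: "{a..b} \<subseteq> ?I" using Icc_subset_edge_ivl ab by blast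
  have cl: "closed (?I \<inter> {..a})" "closed (?I \<inter> {b..})" using closed_edge_ivl by auto
  have i: "?k integrable_on (?I \<inter> {..a})" "?k integrable_on (?I \<inter> {b..})" "?k integrable_on {a..b}"
    using cl sub by (auto intro!: \<kappa>_integrable_on[OF e])
  have neg: "negligible ((?I \<inter> {..a}) \<inter> {a..b})" "negligible (((?I \<inter> {..a}) \<union> {a..b}) \<inter> (?I \<inter> {b..}))"
    using ab(3) by (auto intro: negligible_subset[of "{a}"] negligible_subset[of "{b}"])
  have "?I = (?I \<inter> {..a}) \<union> {a..b} \<union> (?I \<inter> {b..})" using sub by auto
  then have "integral ?I ?k = integral ((?I \<inter> {..a}) \<union> {a..b} \<union> (?I \<inter> {b..})) ?k" by simp
  also have "\<dots> = integral (?I \<inter> {..a}) ?k + integral {a..b} ?k + integral (?I \<inter> {b..}) ?k"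
    using i neg by (subst integral_Un) (auto intro: integrable_Un simp: integral_Un)
  finally show ?thesis
    using flux_le_hi[OF e ab(2)] lo_le_flux[OF e ab(1)] by (simp add: energy_def edge_total_def)
qed

lemma edge_total_nonneg:
  assumes e: "e \<in> edges G"
  shows "0 \<le> edge_total e"
proof -
  obtain t where "lo G e < ereal t" "ereal t < hi G e" using ereal_dense2[OF lo_less_hi[OF e]] by blast
  then have t: "t \<in> edge_ivl G e" by (simp add: edge_ivl_def less_imp_le)
  then show ?thesis using energy_nonneg[OF e t t] energy_le_edge_total[OF e t t] by simp
qed

end

section \<open>Summation over the graph\<close>

text \<open>Unconditional summation may be regrouped freely. With \<open>p\<close> the end vertex of
  an edge, this turns a sum over edges into a sum over vertices.\<close>

lemma has_sum_fibers:
  fixes f :: "'a \<Rightarrow> real"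
  assumes f: "f summable_on S" and p: "p ` S \<subseteq> A" and fin: "\<And>v. v \<in> A \<Longrightarrow> finite {e \<in> S. p e = v}"
  shows "((\<lambda>v. \<Sum>e | e \<in> S \<and> p e = v. f e) has_sum infsum f S) A"
proof -
  let ?T = "Sigma A (\<lambda>v. {e \<in> S. p e = v})"
  have inj: "inj_on snd ?T" by (auto simp: inj_on_def)
  have im: "snd ` ?T = S"
  proof
    show "S \<subseteq> snd ` ?T"
    proof
      fix e assume "e \<in> S"
      then show "e \<in> snd ` ?T" using p by (intro image_eqI[of _ _ "(p e, e)"]) auto
    qed
  qed auto
  have "(f has_sum infsum f S) (snd ` ?T)" unfolding im using f by (rule has_sum_infsum)
  then have "((f \<circ> snd) has_sum infsum f S) ?T" by (simp only: has_sum_reindex[OF inj])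
  then show ?thesis
  proof (rule has_sum_SigmaD)
    fix v assume "v \<in> A"
    then show "((\<lambda>e. (f \<circ> snd) (v, e)) has_sum (\<Sum>e | e \<in> S \<and> p e = v. f e)) {e \<in> S. p e = v}"
      using fin has_sum_finite[of "{e \<in> S. p e = v}" f] by (simp add: o_def)
  qed
qed

context region_eigenfunction
begin

lemma summable_of_density_bound:
  assumes "\<And>e. e \<in> edges G \<Longrightarrow> \<bar>f e\<bar> \<le> C * integral (edge_ivl G e) (\<lambda>t. density (pt G e t))" "0 \<le> C"
  shows "f summable_on edges G"
proof (rule abs_summable_summable, rule nonneg_bdd_above_summable_on)
  have "(\<Sum>e\<in>F. norm (f e)) \<le> C * integral\<^sup>L (arc_length G) density" if F: "F \<subseteq> edges G" "finite F" for F
  proof -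
    have "(\<Sum>e\<in>F. norm (f e)) \<le> (\<Sum>e\<in>F. C * integral (edge_ivl G e) (\<lambda>t. density (pt G e t)))"
      using assms(1) F by (intro sum_mono) auto
    also have "\<dots> \<le> C * integral\<^sup>L (arc_length G) density"
      unfolding sum_distrib_left[symmetric] using assms(2)
      by (intro mult_left_mono sum_integral_edges_le[OF integrable_density density_nonneg F(2,1)])
    finally show ?thesis .
  qed
  then show "bdd_above (sum (\<lambda>e. norm (f e)) ` {F. F \<subseteq> edges G \<and> finite F})"
    by (intro bdd_aboveI) auto
qed simp

lemma summable_flux: "hi_flux summable_on edges G" "lo_flux summable_on edges G"
  using abs_hi_flux_le abs_lo_flux_le Lmin(1) by (auto intro!: summable_of_density_bound[of _ "1 / Lmin + 1"])

text \<open>At a vertex the cutoff is 0 or 1, so this is both \<eta> \<psi> and \<eta>^2 \<psi>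
  there, seen from any incident edge.\<close>

definition vertex_weight :: "'v \<Rightarrow> real" where
  "vertex_weight v = (if Vertex v \<in> W then \<psi> (Vertex v) else 0)"

lemma flux_vertex:
  assumes "e \<in> edges G" "t \<in> edge_ivl G e" "pt G e t = Vertex v"
  shows "flux e t = vertex_weight v * D e t"
  using cutoff_vertex[OF assms] assms(3) by (simp add: flux_def vertex_weight_def)

lemma has_sum_hi_flux:
  "((\<lambda>v. vertex_weight v * (\<Sum>e\<in>hi_edges G v. D e (real_of_ereal (hi G e)))) has_sum infsum hi_flux (edges G)) (verts G)"
proof -
  let ?S = "{e \<in> edges G. hi G e \<noteq> \<infinity>}"
  \<comment> \<open>Infinite ends contribute 0 and are dropped, because \<open>tgt\<close> has no
    meaning for them.\<close>
  have eq: "infsum hi_flux (edges G) = infsum hi_flux ?S"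
    by (rule infsum_cong_neutral) (auto simp: hi_flux_def)
  have sum: "hi_flux summable_on ?S"
    by (rule summable_on_subset_banach[OF summable_flux(1)]) auto
  have S: "{e \<in> ?S. tgt G e = v} = hi_edges G v" for v by (auto simp: hi_edges_def)
  have "((\<lambda>v. \<Sum>e | e \<in> ?S \<and> tgt G e = v. hi_flux e) has_sum infsum hi_flux ?S) (verts G)"
  proof (rule has_sum_fibers[OF sum])
    show "tgt G ` ?S \<subseteq> verts G" using tgt_in_verts by auto
    show "finite {e \<in> ?S. tgt G e = v}" if "v \<in> verts G" for v
      unfolding S using degree that by (simp add: degree_bounded_def)
  qed
  then show ?thesis unfolding eq
  proof (rule has_sum_cong[THEN iffD1, rotated])
    fix v assume "v \<in> verts G"
    have "hi_flux e = vertex_weight v * D e (real_of_ereal (hi G e))" if "e \<in> hi_edges G v" for e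
      using that flux_vertex[OF _ hi_in_edge_ivl pt_hi, of e] by (auto simp: hi_edges_def hi_flux_def)
    then show "(\<Sum>e | e \<in> ?S \<and> tgt G e = v. hi_flux e) =
        vertex_weight v * (\<Sum>e\<in>hi_edges G v. D e (real_of_ereal (hi G e)))"
      using S[of v] by (simp add: sum_distrib_left)
  qed
qed

lemma has_sum_lo_flux:
  "((\<lambda>v. vertex_weight v * (\<Sum>e\<in>lo_edges G v. D e (real_of_ereal (lo G e)))) has_sum infsum lo_flux (edges G)) (verts G)"
proof -
  let ?S = "{e \<in> edges G. lo G e \<noteq> -\<infinity>}"
  have eq: "infsum lo_flux (edges G) = infsum lo_flux ?S"
    by (rule infsum_cong_neutral) (auto simp: lo_flux_def)
  have sum: "lo_flux summable_on ?S"
    by (rule summable_on_subset_banach[OF summable_flux(2)]) auto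
  have S: "{e \<in> ?S. src G e = v} = lo_edges G v" for v by (auto simp: lo_edges_def)
  have "((\<lambda>v. \<Sum>e | e \<in> ?S \<and> src G e = v. lo_flux e) has_sum infsum lo_flux ?S) (verts G)"
  proof (rule has_sum_fibers[OF sum])
    show "src G ` ?S \<subseteq> verts G" using src_in_verts by auto
    show "finite {e \<in> ?S. src G e = v}" if "v \<in> verts G" for v
      unfolding S using degree that by (simp add: degree_bounded_def)
  qed
  then show ?thesis unfolding eq
  proof (rule has_sum_cong[THEN iffD1, rotated])
    fix v assume "v \<in> verts G"
    have "lo_flux e = vertex_weight v * D e (real_of_ereal (lo G e))" if "e \<in> lo_edges G v" for e
      using that flux_vertex[OF _ lo_in_edge_ivl pt_lo, of e] by (auto simp: lo_edges_def lo_flux_def)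
    then show "(\<Sum>e | e \<in> ?S \<and> src G e = v. lo_flux e) =
        vertex_weight v * (\<Sum>e\<in>lo_edges G v. D e (real_of_ereal (lo G e)))"
      using S[of v] by (simp add: sum_distrib_left)
  qed
qed

text \<open>The Kirchhoff condition equates the derivative sums over upper and lower ends at each
  vertex; a loop appears once in each.\<close>

lemma infsum_flux_eq: "infsum hi_flux (edges G) = infsum lo_flux (edges G)"
proof -
  have eq: "(\<Sum>e\<in>hi_edges G v. D e (real_of_ereal (hi G e))) = (\<Sum>e\<in>lo_edges G v. D e (real_of_ereal (lo G e)))"
    if "v \<in> verts G" for v
    using kirchhoff[OF that] by (simp add: sum_negf)
  have "((\<lambda>v. vertex_weight v * (\<Sum>e\<in>hi_edges G v. D e (real_of_ereal (hi G e)))) has_sum infsum lo_flux (edges G)) (verts G)"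
    using has_sum_lo_flux by (rule has_sum_cong[THEN iffD1, rotated]) (simp add: eq)
  then show ?thesis using has_sum_hi_flux has_sum_unique by blast
qed

text \<open>The fluxes cancel only in the sum over all edges, and nonnegativity of each
  \<open>edge_total\<close> carries the resulting bound over to finite families.\<close>

lemma sum_edge_total_le:
  assumes "finite F" "F \<subseteq> edges G"
  shows "sum edge_total F \<le> total_energy"
proof -
  define K where "K e = integral (edge_ivl G e) (\<lambda>t. \<kappa> (pt G e t))" for e
  have K_le: "sum K F \<le> total_energy" if "finite F" "F \<subseteq> edges G" for F
    unfolding K_def using sum_integral_edges_le[OF integrable_\<kappa> \<kappa>_nonneg that] by (simp add: integral_\<kappa>)
  have K: "K summable_on edges G"
  proof (rule nonneg_bdd_above_summable_on)
    show "bdd_above (sum K ` {F. F \<subseteq> edges G \<and> finite F})"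
      using K_le by (intro bdd_aboveI[of _ total_energy]) auto
    show "0 \<le> K e" if "e \<in> edges G" for e
      unfolding K_def using \<kappa>_integrable_on[OF that order_refl closed_edge_ivl] \<kappa>_nonneg
      by (intro Henstock_Kurzweil_Integration.integral_nonneg) auto
  qed
  have "((\<lambda>e. hi_flux e + - lo_flux e + K e) has_sum
      (infsum hi_flux (edges G) + - infsum lo_flux (edges G) + infsum K (edges G))) (edges G)"
    using summable_flux K by (intro has_sum_add has_sum_uminusI has_sum_infsum)
  moreover have "(\<lambda>e. hi_flux e + - lo_flux e + K e) = edge_total"
    by (auto simp: edge_total_def K_def)
  ultimately have "(edge_total has_sum infsum K (edges G)) (edges G)" by (simp add: infsum_flux_eq)
  then have "sum edge_total F \<le> infsum K (edges G)"
    using assms edge_total_nonneg by (intro finite_sum_le_has_sum) auto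
  also have "\<dots> \<le> total_energy" using K K_le by (rule infsum_le_finite_sums)
  finally show ?thesis .
qed

section \<open>The estimate along one route\<close>

lemma sum_energy_edge_le:
  assumes e: "e \<in> edges G" and c: "\<And>s t. (s, t) \<in> set c \<Longrightarrow> s \<in> edge_ivl G e \<and> t \<in> edge_ivl G e"
    and disj: "sorted_wrt (\<lambda>(s, t) (s', t'). closed_segment s t \<inter> closed_segment s' t' = {}) c"
  shows "(\<Sum>(s, t)\<leftarrow>c. energy e (min s t) (max s t)) \<le> edge_total e"
proof (cases "c = []")
  case True
  then show ?thesis using edge_total_nonneg[OF e] by simp
next
  case False
  define P where "P = fst ` set c \<union> snd ` set c"
  have P: "finite P" "P \<noteq> {}" "P \<subseteq> edge_ivl G e" using c False by (auto simp: P_def)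
  \<comment> \<open>The hull of all segment ends is a compact interval even if the edge is
    infinite.\<close>
  define a where "a = Min P"
  define b where "b = Max P"
  have ab: "a \<in> edge_ivl G e" "b \<in> edge_ivl G e"
    using Min_in[OF P(1,2)] Max_in[OF P(1,2)] P(3) by (auto simp: a_def b_def)
  have le: "a \<le> x" "x \<le> b" if "x \<in> P" for x using P that by (simp_all add: a_def b_def)
  have "a \<le> b" using le P(2) by force
  have I: "x \<in> edge_ivl G e" if "a \<le> x" "x \<le> b" for x using edge_ivl_between[OF ab that] .
  have "(\<Sum>(s, t)\<leftarrow>c. energy e (min s t) (max s t)) \<le> energy e a b"
  proof (rule sum_disjoint_segments_le[of a b "energy e", OF _ _ order_refl \<open>a \<le> b\<close> order_refl disj])
    show "0 \<le> energy e x y" if "a \<le> x" "x \<le> y" "y \<le> b" for x y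
      using that by (intro energy_nonneg[OF e] I) auto
    show "energy e x z = energy e x y + energy e y z" if "a \<le> x" "x \<le> y" "y \<le> z" "z \<le> b" for x y z
      using that by (intro energy_add[OF e] I) auto
    fix s t assume "(s, t) \<in> set c"
    then have "s \<in> P" "t \<in> P" by (force simp: P_def)+
    then show "closed_segment s t \<subseteq> {a..b}"
      using le by (auto simp: closed_segment_eq_real_ivl intro: order_trans)
  qed
  also have "\<dots> \<le> edge_total e" by (rule energy_le_edge_total[OF e ab \<open>a \<le> b\<close>])
  finally show ?thesis .
qed

text \<open>The function \<eta> \<psi> on the graph. Vertices are a separate case because
  \<open>cutoff\<close> is indexed by an edge.\<close>

definition localized :: "('v, 'e) gpoint \<Rightarrow> real" where
  "localized x = (case x of Vertex v \<Rightarrow> vertex_weight v | Inner e t \<Rightarrow> cutoff e t * \<psi> x)"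

lemma localized_pt:
  assumes "e \<in> edges G" "t \<in> edge_ivl G e"
  shows "localized (pt G e t) = cutoff e t * \<psi> (pt G e t)"
proof (cases "pt G e t")
  case (Vertex v)
  then show ?thesis using cutoff_vertex[OF assms Vertex] by (simp add: localized_def vertex_weight_def)
next
  case (Inner e' t')
  then have "e' = e" "t' = t" by (auto simp: pt_def split: if_splits)
  then show ?thesis using Inner by (simp add: localized_def)
qed

lemma localized_eq_\<psi>:
  assumes x: "x \<in> W" "l \<le> bdist x"
  shows "localized x = \<psi> x"
proof -
  have "x \<in> points G" using x(1) W_subset by blast
  then show ?thesis
  proof (cases rule: points_cases)
    case (inner e t)
    then show ?thesis
      using localized_pt[of e t] cutoff_eq_1[of e t] x by simp
  qed (use x in \<open>simp add: localized_def vertex_weight_def\<close>)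
qed

lemma localized_eq_0:
  assumes x: "x \<in> points G" "x \<notin> W"
  shows "localized x = 0"
  using x(1)
proof (cases rule: points_cases)
  case (inner e t)
  then have "\<not> 0 < cutoff e t" using cutoff_pos_imp_W[of t e] x(2) by metis
  then have "cutoff e t = 0" using tent_nonneg[OF l, of "core e" t] by linarith
  then show ?thesis using localized_pt[of e t] inner by simp
qed (use x in \<open>simp add: localized_def vertex_weight_def\<close>)

lemma route_square_le:
  assumes "route G x y r"
  shows "(localized y - localized x)\<^sup>2 \<le> r * total_energy"
proof -
  obtain c where c: "chain G x c y" "chain_length c \<le> r" "sorted_wrt segments_disjoint c"
    using route_imp_disjoint_chain[OF assms] .
  define \<phi> where "\<phi> = (\<lambda>(e, s, t). energy e (min s t) (max s t))"
  have "0 \<le> \<phi> (e, s, t) \<and> (localized (pt G e t) - localized (pt G e s))\<^sup>2 \<le> \<bar>s - t\<bar> * \<phi> (e, s, t)"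
    if "e \<in> edges G" "s \<in> edge_ivl G e" "t \<in> edge_ivl G e" for e s t
    using energy_cutoff[OF that(1,2,3)] energy_cutoff[OF that(1,3,2)] that
    by (cases "s \<le> t") (auto simp: \<phi>_def localized_pt power2_commute)
  note bound = chain_square_le[of G \<phi> localized, OF this c(1)]
  have mem: "e \<in> edges G \<and> s \<in> edge_ivl G e \<and> t \<in> edge_ivl G e" if "(e, s, t) \<in> set c" for e s t
    using c(1) that by (induction c arbitrary: x) auto
  \<comment> \<open>Collected by edges, the disjoint segments use the energy of each edge at most
    once.\<close>
  have "(\<Sum>a\<leftarrow>c. \<phi> a) = (\<Sum>e\<in>fst ` set c. \<Sum>a\<leftarrow>filter (\<lambda>a. fst a = e) c. \<phi> a)"
    by (rule sum_list_group) auto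
  also have "\<dots> \<le> (\<Sum>e\<in>fst ` set c. edge_total e)"
  proof (rule sum_mono)
    fix e assume "e \<in> fst ` set c"
    then have e: "e \<in> edges G" using mem by auto
    let ?c = "filter (\<lambda>a. fst a = e) c"
    have "(\<Sum>a\<leftarrow>?c. \<phi> a) = (\<Sum>(s, t)\<leftarrow>map snd ?c. energy e (min s t) (max s t))"
      unfolding map_map o_def by (intro arg_cong[of _ _ sum_list] map_cong) (auto simp: \<phi>_def)
    also have "\<dots> \<le> edge_total e"
    proof (rule sum_energy_edge_le[OF e])
      show "s \<in> edge_ivl G e \<and> t \<in> edge_ivl G e" if "(s, t) \<in> set (map snd ?c)" for s t
        using that mem by auto
      have "sorted_wrt segments_disjoint ?c" using c(3) by (rule sorted_wrt_filter)
      then show "sorted_wrt (\<lambda>(s, t) (s', t'). closed_segment s t \<inter> closed_segment s' t' = {}) (map snd ?c)"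
        unfolding sorted_wrt_map
        by (rule sorted_wrt_mono_rel[rotated]) (auto simp: segments_disjoint_def)
    qed
    finally show "(\<Sum>a\<leftarrow>?c. \<phi> a) \<le> edge_total e" .
  qed
  also have "\<dots> \<le> total_energy" using mem by (intro sum_edge_total_le) auto
  finally have "chain_length c * (\<Sum>a\<leftarrow>c. \<phi> a) \<le> r * total_energy"
    using c(2) bound chain_length_nonneg[of c] by (intro mult_mono) auto
  then show ?thesis using bound by linarith
qed

lemma square_le_total_energy_bdist:
  assumes x: "x \<in> W" "l \<le> bdist x"
  shows "(\<psi> x)\<^sup>2 \<le> total_energy * bdist x"
proof -
  have M: "0 \<le> total_energy" using sum_edge_total_le[of "{}"] by simp
  have route: "(\<psi> x)\<^sup>2 \<le> total_energy * r" if "route G x y r" "y \<in> gtop G frontier_of W" for y r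
    using route_square_le[OF that(1)] localized_eq_\<psi>[OF x] localized_eq_0[of y] frontier_disjoint[OF that(2)]
    by (simp add: mult.commute)
  have ex: "\<exists>r. route G x y r" if "y \<in> gtop G frontier_of W" for y
    using connected x(1) W_subset frontier_disjoint[OF that] by (auto simp: connected_graph_def)
  show ?thesis
  \<comment> \<open>The infimum over routes is taken after division by \<open>total_energy\<close>;
    if that is 0, a single route already gives \<psi>(x) = 0.\<close>
  proof (cases "total_energy = 0")
    case True
    then show ?thesis using route ex W(2) by fastforce
  next
    case False
    then have "0 < total_energy" using M by simp
    have "(\<psi> x)\<^sup>2 / total_energy \<le> gdist G x y" if y: "y \<in> gtop G frontier_of W" for y
    proof -
      have "gdist G x y = Inf {r. route G x y r}" using ex[OF y] by (simp add: gdist_def)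
      moreover have "(\<psi> x)\<^sup>2 / total_energy \<le> r" if "route G x y r" for r
        using route[OF that y] \<open>0 < total_energy\<close> by (simp add: field_simps)
      ultimately show ?thesis using ex[OF y] by (auto intro!: cInf_greatest)
    qed
    then have "(\<psi> x)\<^sup>2 / total_energy \<le> bdist x"
      unfolding gdist_set_def using W(2) by (intro cINF_greatest) auto
    then show ?thesis using \<open>0 < total_energy\<close> by (simp add: field_simps)
  qed
qed

end

theorem theorem6p1:
  fixes G :: "('v, 'e) mgraph"
    and V \<psi> :: "('v, 'e) gpoint \<Rightarrow> real"
    and W :: "('v, 'e) gpoint set"
    and E l Lmin :: real
    and dmax :: nat
  assumes graph: "metric_graph G" "connected_graph G"
    and degree: "degree_bounded G dmax"
    and length: "0 < Lmin" "edge_length_ge G Lmin"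
    and potential: "\<forall>x\<in>points G. 0 \<le> V x" "loc_integrable G V"
    and sublevel: "compactin (gtop G) {x \<in> points G. V x \<le> E}"
    and eigen: "eigenfunction G V E \<psi>"
    and region: "openin (gtop G) W" "gtop G frontier_of W \<noteq> {}"
    and l: "0 < l"
    and no_vertex: "\<forall>v\<in>verts G. Vertex v \<notin> boundary_strip G W l"
  shows "\<forall>x\<in>W. gdist_set G x (gtop G frontier_of W) \<ge> l \<longrightarrow>
    \<bar>\<psi> x\<bar>\<^sup>2 \<le> (1 / l\<^sup>2 * (LINT y:boundary_strip G W l|arc_length G. (\<psi> y)\<^sup>2)
                + (LINT y:W|arc_length G. max (E - V y) 0 * (\<psi> y)\<^sup>2))
               * gdist_set G x (gtop G frontier_of W)"
proof -
  interpret metric_graph G by (rule graph(1))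
  interpret metric_graph_space G Lmin
    by unfold_locales (use length graph(2) in auto)
  interpret graph_region G Lmin W l
    by unfold_locales (use region l no_vertex in auto)
  obtain g where g: "L2_on G g" "\<forall>e\<in>edges G. loc_abs_cont_on (edge_ivl G e) (\<lambda>t. \<psi> (pt G e t)) \<and>
      (AE t in lebesgue. t \<in> edge_ivl G e \<longrightarrow>
        ((\<lambda>t. \<psi> (pt G e t)) has_real_derivative g (pt G e t)) (at t within edge_ivl G e))"
    using eigen unfolding eigenfunction_def H1_on_def by blast
  obtain D where D: "\<forall>e\<in>edges G.
      (\<forall>t\<in>edge_ivl G e. ((\<lambda>t. \<psi> (pt G e t)) has_real_derivative D e t) (at t within edge_ivl G e)) \<and>
      loc_abs_cont_on (edge_ivl G e) (D e) \<and>
      (AE t in lebesgue. t \<in> edge_ivl G e \<longrightarrow>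
         (\<exists>\<psi>2. (D e has_real_derivative \<psi>2) (at t within edge_ivl G e) \<and>
               - \<psi>2 + V (pt G e t) * \<psi> (pt G e t) = E * \<psi> (pt G e t)))"
    "\<forall>v\<in>verts G. (\<Sum>e\<in>lo_edges G v. D e (real_of_ereal (lo G e))) +
      (\<Sum>e\<in>hi_edges G v. - D e (real_of_ereal (hi G e))) = 0"
    using eigen unfolding eigenfunction_def by blast
  have int: "integrable (arc_length G) (\<lambda>x. (\<psi> x)\<^sup>2)" "integrable (arc_length G) (\<lambda>x. V x * (\<psi> x)\<^sup>2)"
    "integrable (arc_length G) (\<lambda>x. (g x)\<^sup>2)"
    using eigen g(1) by (simp_all add: eigenfunction_def H1_on_def L2_on_def)
  interpret region_eigenfunction G Lmin W l V \<psi> g E D dmax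
    by unfold_locales (use degree potential(1) int g(2) D in blast)+
  show ?thesis
    using square_le_total_energy_bdist by (simp add: total_energy_def)
qed

end
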